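(* Let $\mathfrak{F}$ be a 2-recognizable, hereditary, semiregular formation with $\mathfrak{N}\subseteq\mathfrak{F}$, and let $G$ be a finite group. Then $\Gamma_\mathfrak{F}(G)$ is planar if and only if either $G\in\mathfrak{F}$ or $G\cong S_3$.
   Context: $\mathfrak{N}$: finite nilpotent groups. A formation is a class of finite groups closed under homomorphic images and subdirect products; hereditary means closed under subgroups; 2-recognizable means a finite group lies in $\mathfrak{F}$ whenever all its 2-generated subgroups do. $\mathcal{I}_\mathfrak{F}(G)$ is the set of $x\in G$ with $\langle x,g\rangle\in\mathfrak{F}$ for all $g\in G$; $\mathfrak{F}$ is semiregular if $\mathcal{I}_\mathfrak{F}(G)$ is a subgroup of $G$ for every finite group $G$. $\Gamma_\mathfrak{F}(G)$ is the graph with vertex set $G\setminus\mathcal{I}_\mathfrak{F}(G)$ where $g,h$ are adjacent iff $\langle g,h\rangle\notin\mathfrak{F}$. A graph is planar if it can be drawn in the plane with edges meeting only at their endpoints (the empty graph counts as planar). *)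

theory Defs
  imports "HOL-Analysis.Analysis" "HOL-Algebra.Algebra"
begin

definition planar_graph :: "'v set \<Rightarrow> ('v \<Rightarrow> 'v \<Rightarrow> bool) \<Rightarrow> bool" where
  "planar_graph V E \<longleftrightarrow>
     (\<exists>(p :: 'v \<Rightarrow> real^2) (\<gamma> :: 'v \<Rightarrow> 'v \<Rightarrow> real \<Rightarrow> real^2).
        inj_on p V \<and>
        (\<forall>u\<in>V. \<forall>v\<in>V. u \<noteq> v \<and> E u v \<longrightarrow>
            arc (\<gamma> u v) \<and> pathstart (\<gamma> u v) = p u \<and> pathfinish (\<gamma> u v) = p v \<and>
            \<gamma> v u = reversepath (\<gamma> u v) \<and>
            (\<forall>w\<in>V - {u, v}. p w \<notin> path_image (\<gamma> u v))) \<and>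
        (\<forall>u\<in>V. \<forall>v\<in>V. \<forall>x\<in>V. \<forall>y\<in>V.
            u \<noteq> v \<and> E u v \<and> x \<noteq> y \<and> E x y \<and> {u, v} \<noteq> {x, y} \<longrightarrow>
            path_image (\<gamma> u v) \<inter> path_image (\<gamma> x y) \<subseteq> p ` ({u, v} \<inter> {x, y})))"

text \<open>A class of finite groups is represented by a set of groups with carrier
contained in nat (every finite group is isomorphic to such a group), required to be
closed under isomorphism. A group G of arbitrary type belongs to the class iff it is
isomorphic to a member.\<close>

definition in_class :: "nat monoid set \<Rightarrow> ('a, 'b) monoid_scheme \<Rightarrow> bool" where
  "in_class F G \<longleftrightarrow> (\<exists>H\<in>F. G \<cong> H)"

definition group_class :: "nat monoid set \<Rightarrow> bool" where
  "group_class F \<longleftrightarrow>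
     (\<forall>H\<in>F. group H \<and> finite (carrier H)) \<and>
     (\<forall>H\<in>F. \<forall>K :: nat monoid. group K \<and> H \<cong> K \<longrightarrow> K \<in> F)"

definition formation :: "nat monoid set \<Rightarrow> bool" where
  "formation F \<longleftrightarrow> group_class F \<and>
     (\<forall>G\<in>F. \<forall>H :: nat monoid. \<forall>h. group H \<and> h \<in> hom G H \<and> h ` carrier G = carrier H
        \<longrightarrow> H \<in> F) \<and>
     (\<forall>H1\<in>F. \<forall>H2\<in>F. \<forall>K. subgroup K (H1 \<times>\<times> H2) \<and> fst ` K = carrier H1 \<and> snd ` K = carrier H2
        \<longrightarrow> in_class F ((H1 \<times>\<times> H2)\<lparr>carrier := K\<rparr>))"

definition hereditary :: "nat monoid set \<Rightarrow> bool" where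
  "hereditary F \<longleftrightarrow> (\<forall>G\<in>F. \<forall>H. subgroup H G \<longrightarrow> in_class F (G\<lparr>carrier := H\<rparr>))"

definition two_recognizable :: "nat monoid set \<Rightarrow> bool" where
  "two_recognizable F \<longleftrightarrow>
     (\<forall>G :: nat monoid. group G \<and> finite (carrier G) \<and>
        (\<forall>x\<in>carrier G. \<forall>y\<in>carrier G. in_class F (subgroup_generated G {x, y}))
        \<longrightarrow> G \<in> F)"

definition I_F :: "nat monoid set \<Rightarrow> ('a, 'b) monoid_scheme \<Rightarrow> 'a set" where
  "I_F F G = {x \<in> carrier G. \<forall>g\<in>carrier G. in_class F (subgroup_generated G {x, g})}"

definition semiregular :: "nat monoid set \<Rightarrow> bool" where
  "semiregular F \<longleftrightarrow>
     (\<forall>G :: nat monoid. group G \<and> finite (carrier G) \<longrightarrow> subgroup (I_F F G) G)"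

definition commutator_subgroup :: "('a, 'b) monoid_scheme \<Rightarrow> 'a set \<Rightarrow> 'a set \<Rightarrow> 'a set" where
  "commutator_subgroup G H K =
     generate G {h \<otimes>\<^bsub>G\<^esub> k \<otimes>\<^bsub>G\<^esub> inv\<^bsub>G\<^esub> h \<otimes>\<^bsub>G\<^esub> inv\<^bsub>G\<^esub> k | h k. h \<in> H \<and> k \<in> K}"

fun lower_central :: "('a, 'b) monoid_scheme \<Rightarrow> nat \<Rightarrow> 'a set" where
  "lower_central G 0 = carrier G"
| "lower_central G (Suc n) = commutator_subgroup G (lower_central G n) (carrier G)"

definition nilpotent_group :: "('a, 'b) monoid_scheme \<Rightarrow> bool" where
  "nilpotent_group G \<longleftrightarrow> group G \<and> (\<exists>n. lower_central G n = {\<one>\<^bsub>G\<^esub>})"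

definition contains_nilpotent :: "nat monoid set \<Rightarrow> bool" where
  "contains_nilpotent F \<longleftrightarrow>
     (\<forall>G :: nat monoid. nilpotent_group G \<and> finite (carrier G) \<longrightarrow> G \<in> F)"

definition Gamma_vertices :: "nat monoid set \<Rightarrow> ('a, 'b) monoid_scheme \<Rightarrow> 'a set" where
  "Gamma_vertices F G = carrier G - I_F F G"

definition Gamma_adj :: "nat monoid set \<Rightarrow> ('a, 'b) monoid_scheme \<Rightarrow> 'a \<Rightarrow> 'a \<Rightarrow> bool" where
  "Gamma_adj F G g h \<longleftrightarrow> \<not> in_class F (subgroup_generated G {g, h})"

end

theory Submission
  imports Defs
begin


text \<open>For groups outside the class, planarity enters only through the fact that \<open>K\<^sub>3\<^sub>,\<^sub>3\<close> is not planar, which follows from the Jordan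
curve theorem and Janiszewski's theorem.

Write \<open>x \<sim> y\<close> if \<open>\<langle>x, y\<rangle>\<close> is not in the class. Many pairs generate the same subgroup as a given
adjacent pair, and each way of arranging them into a \<open>K\<^sub>3\<^sub>,\<^sub>3\<close> yields a relation. If \<open>x \<sim> y\<close> and
\<open>x\<^sup>2 \<noteq> 1\<close>, then \<open>y\<close> inverts \<open>x\<close>, and \<open>y\<^sup>2 = 1\<close> since otherwise \<open>\<langle>x, y\<rangle>\<close> would be nilpotent; finally
\<open>x\<^sup>3 = 1\<close>, so that \<open>\<langle>x, y\<rangle> \<cong> S\<^sub>3\<close>. Hence, outside the class, \<open>S\<^sub>3\<close> embeds in \<open>G\<close> and is itself outside the class. Further
copies of \<open>K\<^sub>3\<^sub>,\<^sub>3\<close> show that \<open>\<I>(G)\<close> is trivial, so every element has order at most 3, that \<open>x\<close>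
generates its own centralizer, and that every involution lies in \<open>H = \<langle>x, y\<rangle>\<close>. Then \<open>\<langle>x\<rangle>\<close> is normal
in \<open>G\<close>, whence \<open>G = H\<close>. Conversely, the graph of \<open>S\<^sub>3\<close> lies in \<open>K\<^sub>5\<close> minus an edge.\<close>

section \<open>Nonplanarity of the complete bipartite graph on 3 + 3 vertices\<close>

text \<open>The two arcs form a Jordan curve, and the connected set \<open>T\<close> lies on one of
  its two sides. That side is called \<open>E\<close> and the other \<open>D\<close>, whichever of
  them is bounded, so later arguments do not distinguish inside from outside.\<close>

lemma jordan_sides_of_arc_pair:
  fixes c d :: "real \<Rightarrow> complex"
  assumes "arc c" "arc d" "pathstart c = a" "pathfinish c = b" "pathstart d = a" "pathfinish d = b"
    and int: "path_image c \<inter> path_image d = {a, b}"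
    and T: "connected T" "T \<inter> (path_image c \<union> path_image d) = {}" "z \<in> T"
  obtains D E where "D \<noteq> {}" "open D" "connected D" "open E" "connected E" "T \<subseteq> E" "D \<inter> E = {}"
    "D \<union> E = - (path_image c \<union> path_image d)" "frontier D = path_image c \<union> path_image d"
proof -
  have sp: "simple_path (c +++ reversepath d)"
    using assms by (subst simple_path_join_loop_eq) (auto simp: arc_reversepath)
  have loop: "pathfinish (c +++ reversepath d) = pathstart (c +++ reversepath d)"
    using assms by simp
  have im: "path_image (c +++ reversepath d) = path_image c \<union> path_image d"
    using assms by (simp add: path_image_join)
  obtain I J where IJ: "I \<noteq> {}" "open I" "connected I" "J \<noteq> {}" "open J" "connected J"
    "bounded I" "\<not> bounded J" "I \<inter> J = {}" "I \<union> J = - (path_image c \<union> path_image d)"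
    "frontier I = path_image c \<union> path_image d" "frontier J = path_image c \<union> path_image d"
    by (rule Jordan_curve[OF sp loop, unfolded im])
  have sub: "T \<subseteq> I \<union> J" using IJ T by auto
  show thesis
  proof (cases "z \<in> I")
    case True
    then have "T \<subseteq> I"
      using connectedD[OF T(1) \<open>open I\<close> \<open>open J\<close>] IJ(9) sub T(3) by auto
    then show ?thesis using that[of J I] IJ by (auto simp: Un_commute)
  next
    case False
    then have "T \<subseteq> J"
      using connectedD[OF T(1) \<open>open I\<close> \<open>open J\<close>] IJ(9) sub T(3) by auto
    then show ?thesis using that[of I J] IJ by auto
  qed
qed

text \<open>\<open>D\<close> avoids \<open>A'\<close>, hence lies on one side of it; if
  \<open>D\<close> meets \<open>D'\<close>, it lies in \<open>D'\<close>. By symmetry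
  \<open>D = D'\<close>, although their frontiers \<open>A\<close> and \<open>A'\<close>
  differ.\<close>

lemma theta_curve_side_not_common:
  fixes D D' :: "complex set"
  assumes "connected D" "open D" "connected D'" "open D'" "open E" "open E'"
    and "D \<inter> E = {}" "D' \<inter> E' = {}" "D \<union> E = - A" "D' \<union> E' = - A'"
    and "frontier D = A" "frontier D' = A'" "D \<inter> A' = {}" "D' \<inter> A = {}" "A \<noteq> A'"
  shows "D \<inter> D' = {}"
proof (rule ccontr)
  assume ne: "D \<inter> D' \<noteq> {}"
  have "D \<subseteq> D' \<union> E'" "D' \<subseteq> D \<union> E" using assms by auto
  then have "D \<subseteq> D'" "D' \<subseteq> D"
    using connectedD[OF \<open>connected D\<close> \<open>open D'\<close> \<open>open E'\<close>]
      connectedD[OF \<open>connected D'\<close> \<open>open D\<close> \<open>open E\<close>] ne assms(7,8) by auto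
  then show False using assms(11,12,15) by auto
qed

lemma connected_arc_interior:
  assumes "arc c"
  shows "connected (path_image c - {pathstart c, pathfinish c})"
proof -
  have "c t \<noteq> c 0" "c t \<noteq> c 1" if "0 < t" "t < 1" for t
    using that arcD[OF assms, of t 0] arcD[OF assms, of t 1] by auto
  then have "c ` ({0..1} - {0, 1}) = c ` {0..1} - {c 0, c 1}"
    by (auto simp: less_le)
  moreover have "{0..1} - {0, 1} = {0<..<1::real}" by auto
  ultimately have "path_image c - {pathstart c, pathfinish c} = c ` {0<..<1}"
    by (simp add: path_image_def pathstart_def pathfinish_def)
  moreover have "continuous_on {0<..<1} c"
    using assms arc_imp_path continuous_on_subset unfolding path_def
    by (metis greaterThanLessThan_subseteq_atLeastAtMost_iff order_refl)
  ultimately show ?thesis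
    by (simp add: connected_continuous_image)
qed

text \<open>Choose a point \<open>q\<close> on the side of \<open>c2 \<union> c3\<close> away from \<open>z\<close>. Neither of the other two Jordan curves
separates \<open>q\<close> from \<open>z\<close>, and these two curves meet in the connected set \<open>c1\<close>; so by Janiszewski's
theorem the whole theta curve does not separate them either.\<close>

lemma theta_curve_no_common_point:
  fixes c1 c2 c3 :: "real \<Rightarrow> complex"
  assumes arcs: "arc c1" "arc c2" "arc c3"
    and ends: "pathstart c1 = a" "pathfinish c1 = b" "pathstart c2 = a" "pathfinish c2 = b"
      "pathstart c3 = a" "pathfinish c3 = b"
    and int: "path_image c1 \<inter> path_image c2 = {a, b}" "path_image c1 \<inter> path_image c3 = {a, b}"
      "path_image c2 \<inter> path_image c3 = {a, b}"
    and T1: "connected T1" "T1 \<inter> (path_image c2 \<union> path_image c3) = {}" "z \<in> T1" "path_image c1 - {a, b} \<subseteq> T1"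
    and T2: "connected T2" "T2 \<inter> (path_image c1 \<union> path_image c3) = {}" "z \<in> T2" "path_image c2 - {a, b} \<subseteq> T2"
    and T3: "connected T3" "T3 \<inter> (path_image c1 \<union> path_image c2) = {}" "z \<in> T3" "path_image c3 - {a, b} \<subseteq> T3"
  shows False
proof -
  obtain D1 E1 where D1: "D1 \<noteq> {}" "open D1" "connected D1" "open E1" "connected E1" "T1 \<subseteq> E1" "D1 \<inter> E1 = {}"
    "D1 \<union> E1 = - (path_image c2 \<union> path_image c3)" "frontier D1 = path_image c2 \<union> path_image c3"
    using jordan_sides_of_arc_pair[OF arcs(2,3) ends(3-6) int(3) T1(1-3)] .
  obtain D2 E2 where D2: "D2 \<noteq> {}" "open D2" "connected D2" "open E2" "connected E2" "T2 \<subseteq> E2" "D2 \<inter> E2 = {}"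
    "D2 \<union> E2 = - (path_image c1 \<union> path_image c3)" "frontier D2 = path_image c1 \<union> path_image c3"
    using jordan_sides_of_arc_pair[OF arcs(1,3) ends(1,2,5,6) int(2) T2(1-3)] .
  obtain D3 E3 where D3: "D3 \<noteq> {}" "open D3" "connected D3" "open E3" "connected E3" "T3 \<subseteq> E3" "D3 \<inter> E3 = {}"
    "D3 \<union> E3 = - (path_image c1 \<union> path_image c2)" "frontier D3 = path_image c1 \<union> path_image c2"
    using jordan_sides_of_arc_pair[OF arcs(1,2) ends(1-4) int(1) T3(1-3)] .
  \<comment> \<open>An interior point of \<open>c1\<close>, which shows that the Jordan curves
    through \<open>c1\<close> differ from the union of \<open>c2\<close> and
    \<open>c3\<close>.\<close>
  have m1: "c1 (1/2) \<in> path_image c1 - {a, b}"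
    using arcs(1) ends(1,2) arcD[OF arcs(1), of "1/2" 0] arcD[OF arcs(1), of "1/2" 1]
    by (auto simp: path_image_def pathstart_def pathfinish_def)
  have ends_in: "a \<in> path_image c1" "a \<in> path_image c2" "a \<in> path_image c3"
    "b \<in> path_image c1" "b \<in> path_image c2" "b \<in> path_image c3"
    using int by blast+
  \<comment> \<open>The interior of \<open>c1\<close> is on the side \<open>E1\<close> together with
    \<open>z\<close>, and the ends of \<open>c1\<close> are on the Jordan curve itself.\<close>
  have dis1: "D1 \<inter> path_image c1 = {}" using D1(6,7,8) T1(4) ends_in by blast
  have dis2: "D2 \<inter> path_image c2 = {}" using D2(6,7,8) T2(4) ends_in by blast
  have dis3: "D3 \<inter> path_image c3 = {}" using D3(6,7,8) T3(4) ends_in by blast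
  have "D1 \<inter> D3 = {}"
  proof (rule theta_curve_side_not_common[OF D1(3,2) D3(3,2) D1(4) D3(4) D1(7) D3(7) D1(8) D3(8) D1(9) D3(9)])
    show "D1 \<inter> (path_image c1 \<union> path_image c2) = {}" using D1(8) dis1 by blast
    show "D3 \<inter> (path_image c2 \<union> path_image c3) = {}" using D3(8) dis3 by blast
    show "path_image c2 \<union> path_image c3 \<noteq> path_image c1 \<union> path_image c2" using m1 int by blast
  qed
  moreover have "D1 \<inter> D2 = {}"
  proof (rule theta_curve_side_not_common[OF D1(3,2) D2(3,2) D1(4) D2(4) D1(7) D2(7) D1(8) D2(8) D1(9) D2(9)])
    show "D1 \<inter> (path_image c1 \<union> path_image c3) = {}" using D1(8) dis1 by blast
    show "D2 \<inter> (path_image c2 \<union> path_image c3) = {}" using D2(8) dis2 by blast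
    show "path_image c2 \<union> path_image c3 \<noteq> path_image c1 \<union> path_image c3" using m1 int by blast
  qed
  moreover obtain q where q: "q \<in> D1" using D1(1) by blast
  moreover have "q \<notin> path_image c1 \<union> path_image c2 \<union> path_image c3" using q D1(8) dis1 by blast
  ultimately have qE: "q \<in> E2" "q \<in> E3" using D2(8) D3(8) by blast+
  have S: "connected_component (- (path_image c1 \<union> path_image c2)) q z"
    unfolding connected_component_def using D3(5,6,8) T3(3) qE by (intro exI[of _ E3]) blast
  have T: "connected_component (- (path_image c1 \<union> path_image c3)) q z"
    unfolding connected_component_def using D2(5,6,8) T2(3) qE by (intro exI[of _ E2]) blast
  have "(path_image c1 \<union> path_image c2) \<inter> (path_image c1 \<union> path_image c3) = path_image c1"
    using int ends_in by blast
  then have conn: "connected ((path_image c1 \<union> path_image c2) \<inter> (path_image c1 \<union> path_image c3))"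
    using arcs by (simp add: arc_imp_path connected_path_image)
  have "connected_component (- ((path_image c1 \<union> path_image c2) \<union> (path_image c1 \<union> path_image c3))) q z"
    by (rule Janiszewski[OF _ _ conn S T])
      (use arcs in \<open>auto simp: arc_imp_path compact_path_image intro!: compact_Un compact_imp_closed\<close>)
  \<comment> \<open>\<open>D1 \<union> E1\<close> is the complement of \<open>c2\<close> and
    \<open>c3\<close>, where \<open>q\<close> and \<open>z\<close> lie on opposite sides.\<close>
  then have "connected_component (D1 \<union> E1) q z"
    by (rule connected_component_of_subset) (use D1(8) in blast)
  then obtain C where "connected C" "C \<subseteq> D1 \<union> E1" "q \<in> C" "z \<in> C"
    unfolding connected_component_def by blast
  moreover have "z \<in> E1" using D1(6) T1(3) by blast
  ultimately show False
    using connectedD[of C D1 E1] D1(2,4,7) q by blast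
qed

text \<open>The three paths from \<open>a 0\<close> through \<open>b k\<close> to \<open>a 1\<close>
  form a theta curve. The point \<open>a 2\<close> is joined to the interior of each path without
  touching the other two, which \<open>theta_curve_no_common_point\<close> rules out.\<close>

lemma no_plane_K33:
  fixes a b :: "nat \<Rightarrow> complex" and g :: "nat \<Rightarrow> nat \<Rightarrow> real \<Rightarrow> complex"
  assumes arc: "\<And>i j. i < 3 \<Longrightarrow> j < 3 \<Longrightarrow> arc (g i j)"
    and start: "\<And>i j. i < 3 \<Longrightarrow> j < 3 \<Longrightarrow> pathstart (g i j) = a i"
    and finish: "\<And>i j. i < 3 \<Longrightarrow> j < 3 \<Longrightarrow> pathfinish (g i j) = b j"
    and int: "\<And>i j i' j' x. i < 3 \<Longrightarrow> j < 3 \<Longrightarrow> i' < 3 \<Longrightarrow> j' < 3 \<Longrightarrow> (i, j) \<noteq> (i', j') \<Longrightarrow>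
      x \<in> path_image (g i j) \<Longrightarrow> x \<in> path_image (g i' j') \<Longrightarrow> i = i' \<and> x = a i \<or> j = j' \<and> x = b j"
  shows False
proof -
  have ab: "a i \<noteq> b j" if "i < 3" "j < 3" for i j
    using arc_distinct_ends[OF arc[OF that]] start[OF that] finish[OF that] by simp
  have a_in: "a i \<in> path_image (g i j)" and b_in: "b j \<in> path_image (g i j)" if "i < 3" "j < 3" for i j
    using pathstart_in_path_image[of "g i j"] pathfinish_in_path_image[of "g i j"] start[OF that] finish[OF that]
    by simp_all
  define c where "c k = g 0 k +++ reversepath (g 1 k)" for k
  \<comment> \<open>The interior of the path through \<open>b k\<close>, with the edge from
    \<open>a 2\<close> attached to it at \<open>b k\<close>.\<close>
  define T where "T k = (path_image (c k) - {a 0, a 1}) \<union> path_image (g 2 k)" for k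
  have c_im: "path_image (c k) = path_image (g 0 k) \<union> path_image (g 1 k)" if "k < 3" for k
    unfolding c_def using that by (simp add: path_image_join finish)
  have c_start: "pathstart (c k) = a 0" and c_finish: "pathfinish (c k) = a 1" if "k < 3" for k
    unfolding c_def using that by (simp_all add: start)
  have c_arc: "arc (c k)" if "k < 3" for k
    unfolding c_def
  proof (rule arc_join)
    show "path_image (g 0 k) \<inter> path_image (reversepath (g 1 k)) \<subseteq> {pathstart (reversepath (g 1 k))}"
      using int[of 0 k 1 k] that by (auto simp: finish)
  qed (use that in \<open>auto simp: arc finish arc_reversepath\<close>)
  have c_int: "path_image (c k) \<inter> path_image (c l) = {a 0, a 1}" if "k < 3" "l < 3" "k \<noteq> l" for k l
  proof
    show "path_image (c k) \<inter> path_image (c l) \<subseteq> {a 0, a 1}"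
      using int[of 0 k 0 l] int[of 0 k 1 l] int[of 1 k 0 l] int[of 1 k 1 l] that by (auto simp: c_im)
    show "{a 0, a 1} \<subseteq> path_image (c k) \<inter> path_image (c l)"
      using that a_in by (auto simp: c_im)
  qed
  have T_conn: "connected (T k)" if "k < 3" for k
    unfolding T_def
  proof (rule connected_Un)
    show "connected (path_image (c k) - {a 0, a 1})"
      using connected_arc_interior[OF c_arc[OF that]] by (simp add: c_start c_finish that)
    show "connected (path_image (g 2 k))"
      using arc[of 2 k] that by (simp add: arc_imp_path connected_path_image)
    have "b k \<in> (path_image (c k) - {a 0, a 1}) \<inter> path_image (g 2 k)"
      using b_in[of 0 k] b_in[of 2 k] ab[of 0 k] ab[of 1 k] that by (auto simp: c_im)
    then show "(path_image (c k) - {a 0, a 1}) \<inter> path_image (g 2 k) \<noteq> {}" by blast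
  qed
  have T_dis: "T k \<inter> path_image (c l) = {}" if "k < 3" "l < 3" "k \<noteq> l" for k l
    unfolding T_def using c_int[OF that] int[of 2 k 0 l] int[of 2 k 1 l] that
    by (auto simp: c_im)
  have T_in: "a 2 \<in> T k" "path_image (c k) - {a 0, a 1} \<subseteq> T k" if "k < 3" for k
    unfolding T_def using a_in[of 2 k] that by auto
  show False
    by (rule theta_curve_no_common_point[of "c 0" "c 1" "c 2" "a 0" "a 1" "T 0" "a 2" "T 1" "T 2"])
      (auto simp: c_arc c_start c_finish c_int T_conn T_dis T_in Int_Un_distrib
            intro!: set_mp[OF T_in(2)])
qed

lemma planar_graph_no_K33:
  fixes u v :: "nat \<Rightarrow> 'v"
  assumes "planar_graph V E"
    and V: "\<And>i. i < 3 \<Longrightarrow> u i \<in> V" "\<And>i. i < 3 \<Longrightarrow> v i \<in> V"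
    and inj: "inj_on u {..<3}" "inj_on v {..<3}"
    and E: "\<And>i j. i < 3 \<Longrightarrow> j < 3 \<Longrightarrow> u i \<noteq> v j \<and> E (u i) (v j)"
  shows False
proof -
  obtain p :: "'v \<Rightarrow> real^2" and \<gamma> where
    arcs': "\<forall>u\<in>V. \<forall>v\<in>V. u \<noteq> v \<and> E u v \<longrightarrow>
            arc (\<gamma> u v) \<and> pathstart (\<gamma> u v) = p u \<and> pathfinish (\<gamma> u v) = p v \<and>
            \<gamma> v u = reversepath (\<gamma> u v) \<and>
            (\<forall>w\<in>V - {u, v}. p w \<notin> path_image (\<gamma> u v))"
    and cross': "\<forall>u\<in>V. \<forall>v\<in>V. \<forall>x\<in>V. \<forall>y\<in>V.
            u \<noteq> v \<and> E u v \<and> x \<noteq> y \<and> E x y \<and> {u, v} \<noteq> {x, y} \<longrightarrow>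
            path_image (\<gamma> u v) \<inter> path_image (\<gamma> x y) \<subseteq> p ` ({u, v} \<inter> {x, y})"
    using assms(1) unfolding planar_graph_def by (elim exE conjE)
  have arcs: "arc (\<gamma> u v)" "pathstart (\<gamma> u v) = p u" "pathfinish (\<gamma> u v) = p v"
    if "u \<in> V" "v \<in> V" "u \<noteq> v \<and> E u v" for u v
    using arcs' that by simp_all
  have cross: "path_image (\<gamma> u v) \<inter> path_image (\<gamma> x y) \<subseteq> p ` ({u, v} \<inter> {x, y})"
    if "u \<in> V" "v \<in> V" "x \<in> V" "y \<in> V" "u \<noteq> v \<and> E u v" "x \<noteq> y \<and> E x y" "{u, v} \<noteq> {x, y}" for u v x y
    using cross' that by simp
  \<comment> \<open>The results on plane curves above are about \<open>complex\<close>; this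
    injective continuous map carries the drawing there.\<close>
  define f :: "real^2 \<Rightarrow> complex" where "f w = Complex (w $ 1) (w $ 2)" for w
  have f_inj: "inj f"
    by (auto simp: inj_def f_def vec_eq_iff forall_2)
  have f_cont: "continuous_on S f" for S
    unfolding f_def Complex_eq by (intro continuous_intros)
  have "arc (f \<circ> \<gamma> (u i) (v j))" if "i < 3" "j < 3" for i j
    unfolding arc_def
  proof
    have "arc (\<gamma> (u i) (v j))" using arcs(1) V E that by simp
    then have "path (\<gamma> (u i) (v j))" "inj_on (\<gamma> (u i) (v j)) {0..1}" by (simp_all add: arc_def)
    then show "path (f \<circ> \<gamma> (u i) (v j))" "inj_on (f \<circ> \<gamma> (u i) (v j)) {0..1}"
      using f_cont by (auto intro: path_continuous_image comp_inj_on inj_on_subset[OF f_inj])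
  qed
  then show False
  proof (rule no_plane_K33)
    fix i j :: nat assume "i < 3" "j < 3"
    then show "pathstart (f \<circ> \<gamma> (u i) (v j)) = (f \<circ> p \<circ> u) i" "pathfinish (f \<circ> \<gamma> (u i) (v j)) = (f \<circ> p \<circ> v) j"
      using arcs(2,3) V E by (simp_all add: pathstart_compose pathfinish_compose)
  next
    fix i j i' j' :: nat and x
    assume ij: "i < 3" "j < 3" "i' < 3" "j' < 3" "(i, j) \<noteq> (i', j')"
      and "x \<in> path_image (f \<circ> \<gamma> (u i) (v j))" "x \<in> path_image (f \<circ> \<gamma> (u i') (v j'))"
    then obtain w where w: "x = f w" "w \<in> path_image (\<gamma> (u i) (v j)) \<inter> path_image (\<gamma> (u i') (v j'))"
      using f_inj by (auto simp: path_image_compose inj_def)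
    \<comment> \<open>No \<open>u i\<close> equals any \<open>v j\<close>, so two edges can share an
      endpoint only within one side.\<close>
    have uv: "u i = u i' \<longleftrightarrow> i = i'" "v j = v j' \<longleftrightarrow> j = j'" "u i \<noteq> v j" "u i \<noteq> v j'" "u i' \<noteq> v j" "u i' \<noteq> v j'"
      using inj ij E by (auto simp: inj_on_def)
    have "w \<in> p ` ({u i, v j} \<inter> {u i', v j'})"
      by (rule subsetD[OF cross w(2)]) (use ij V E uv in \<open>simp_all add: doubleton_eq_iff\<close>)
    then show "i = i' \<and> x = (f \<circ> p \<circ> u) i \<or> j = j' \<and> x = (f \<circ> p \<circ> v) j"
      using w uv by auto
  qed
qed

corollary planar_graph_no_K33_lists:
  assumes "planar_graph V E" "set xs \<subseteq> V" "set ys \<subseteq> V" "distinct xs" "distinct ys"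
    and "length xs = 3" "length ys = 3"
    and "\<And>x y. x \<in> set xs \<Longrightarrow> y \<in> set ys \<Longrightarrow> x \<noteq> y \<and> E x y"
  shows False
  by (rule planar_graph_no_K33[OF assms(1), of "(!) xs" "(!) ys"])
    (use assms(2-) in \<open>auto simp: inj_on_def nth_eq_iff_index_eq\<close>)



section \<open>A straight-line drawing of the complete graph on 5 vertices minus an edge\<close>

text \<open>The points are (-4,0), (4,0), (0,3), (0,1) and (0,8), numbered from 0. Points 2, 3 and 4
  are collinear with 2 between the others, so the edge between 3 and 4 is the one that cannot be a
  segment.\<close>

definition K5e_x :: "nat \<Rightarrow> real" where "K5e_x i = [-4, 4, 0, 0, 0] ! i"
definition K5e_y :: "nat \<Rightarrow> real" where "K5e_y i = [0, 0, 3, 1, 8] ! i"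

lemma K5e_x_simps [simp]:
  "K5e_x 0 = -4" "K5e_x (Suc 0) = 4" "K5e_x 2 = 0" "K5e_x 3 = 0" "K5e_x 4 = 0"
  by (simp_all add: K5e_x_def)

lemma K5e_y_simps [simp]:
  "K5e_y 0 = 0" "K5e_y (Suc 0) = 0" "K5e_y 2 = 3" "K5e_y 3 = 1" "K5e_y 4 = 8"
  by (simp_all add: K5e_y_def)

definition K5e_point :: "nat \<Rightarrow> real^2" where "K5e_point i = vector [K5e_x i, K5e_y i]"

lemma nat_less_5: "(i::nat) < 5 \<longleftrightarrow> i = 0 \<or> i = Suc 0 \<or> i = 2 \<or> i = 3 \<or> i = 4"
  by auto

lemma K5e_edges:
  assumes "i < j" "j < 5" "(i, j) \<noteq> (3, 4)"
  shows "(i, j) \<in> {(0,Suc 0),(0,2),(0,3),(0,4),(Suc 0,2),(Suc 0,3),(Suc 0,4),(2,3),(2,4)}"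
proof -
  have "i < 5" using assms by simp
  with assms show ?thesis unfolding nat_less_5 by auto
qed

lemma K5e_point_eq: "v = K5e_point i \<longleftrightarrow> v $ 1 = K5e_x i \<and> v $ 2 = K5e_y i"
  by (auto simp: K5e_point_def vec_eq_iff forall_2 vector_2)

lemma K5e_point_inj: "inj_on K5e_point {..<5}"
proof (rule inj_onI)
  fix i j :: nat assume "i \<in> {..<5}" "j \<in> {..<5}" "K5e_point i = K5e_point j"
  then have "i < 5" "j < 5" "K5e_x i = K5e_x j" "K5e_y i = K5e_y j"
    using K5e_point_eq[of "K5e_point i" i] K5e_point_eq[of "K5e_point i" j] by auto
  then show "i = j" unfolding nat_less_5 by auto
qed

lemma in_segment_K5e:
  assumes "v \<in> closed_segment (K5e_point i) (K5e_point j)"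
  obtains s where "0 \<le> s" "s \<le> 1" "v $ 1 = K5e_x i + s * (K5e_x j - K5e_x i)"
    "v $ 2 = K5e_y i + s * (K5e_y j - K5e_y i)"
proof -
  obtain s where "0 \<le> s" "s \<le> 1" "v = (1 - s) *\<^sub>R K5e_point i + s *\<^sub>R K5e_point j"
    using assms unfolding closed_segment_def by blast
  then show thesis
    by (intro that[of s]) (simp_all add: K5e_point_def vector_2, simp_all add: algebra_simps)
qed

text \<open>The coordinates are numerals, so each pair of edges gives two linear equations in the
  segment parameters \<open>s\<close> and \<open>t\<close>: a finite check by linear
  arithmetic.\<close>

lemma K5e_segments_meet:
  assumes "i < j" "j < 5" "(i, j) \<noteq> (3, 4)" "k < l" "l < 5" "(k, l) \<noteq> (3, 4)" "(i, j) \<noteq> (k, l)"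
    and "v \<in> closed_segment (K5e_point i) (K5e_point j)" "v \<in> closed_segment (K5e_point k) (K5e_point l)"
  shows "v \<in> K5e_point ` ({i, j} \<inter> {k, l})"
proof -
  obtain s where s: "0 \<le> s" "s \<le> 1" "v $ 1 = K5e_x i + s * (K5e_x j - K5e_x i)"
    "v $ 2 = K5e_y i + s * (K5e_y j - K5e_y i)"
    using in_segment_K5e[OF assms(8)] .
  obtain t where t: "0 \<le> t" "t \<le> 1" "v $ 1 = K5e_x k + t * (K5e_x l - K5e_x k)"
    "v $ 2 = K5e_y k + t * (K5e_y l - K5e_y k)"
    using in_segment_K5e[OF assms(9)] .
  show ?thesis
    using K5e_edges[OF assms(1-3)] K5e_edges[OF assms(4-6)] assms(7) s t
    unfolding insert_iff prod.inject empty_iff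
    by (elim disjE; (elim conjE)?; simp add: image_def K5e_point_eq; linarith)
qed

lemma K5e_point_notin_segment:
  assumes "i < j" "j < 5" "(i, j) \<noteq> (3, 4)" "k < 5" "k \<notin> {i, j}"
  shows "K5e_point k \<notin> closed_segment (K5e_point i) (K5e_point j)"
proof
  assume "K5e_point k \<in> closed_segment (K5e_point i) (K5e_point j)"
  then obtain s where "0 \<le> s" "s \<le> 1" "K5e_x k = K5e_x i + s * (K5e_x j - K5e_x i)"
    "K5e_y k = K5e_y i + s * (K5e_y j - K5e_y i)"
    by (rule in_segment_K5e) (auto simp: K5e_point_def vector_2)
  then show False
    using K5e_edges[OF assms(1-3)] assms(4-5)
    unfolding nat_less_5 insert_iff prod.inject empty_iff
    by (elim disjE; (elim conjE)?; simp; linarith?)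
qed

lemma K5_minus_edge_planar:
  assumes idx: "inj_on f V" "f ` V \<subseteq> {..<5::nat}"
    and E: "\<And>u v. u \<in> V \<Longrightarrow> v \<in> V \<Longrightarrow> E u v \<Longrightarrow> {f u, f v} \<noteq> {3, 4}"
  shows "planar_graph V E"
proof -
  define p where "p = K5e_point \<circ> f"
  have f5: "f u < 5" if "u \<in> V" for u using idx that by auto
  have f_inj: "f u = f v \<longleftrightarrow> u = v" if "u \<in> V" "v \<in> V" for u v
    using idx that by (auto simp: inj_on_def)
  have p_inj: "inj_on p V"
    unfolding p_def using idx K5e_point_inj by (auto intro: comp_inj_on inj_on_subset)
  \<comment> \<open>The finite checks treat index pairs in increasing order, and a segment does not
    depend on its direction.\<close>
  have ordered: "\<exists>i j. i < j \<and> j < 5 \<and> (i, j) \<noteq> (3, 4) \<and> {f u, f v} = {i, j} \<and>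
      closed_segment (p u) (p v) = closed_segment (K5e_point i) (K5e_point j)"
    if uv: "u \<in> V" "v \<in> V" "u \<noteq> v" "E u v" for u v
  proof (cases "f u < f v")
    case True
    then show ?thesis using E[OF uv(1,2,4)] f5 uv
      by (intro exI[of _ "f u"] exI[of _ "f v"]) (auto simp: p_def)
  next
    case False
    then have "f v < f u" using f_inj uv by (metis linorder_neqE_nat)
    then show ?thesis using E[OF uv(1,2,4)] f5 uv
      by (intro exI[of _ "f v"] exI[of _ "f u"]) (auto simp: p_def closed_segment_commute)
  qed
  have avoid: "p w \<notin> closed_segment (p u) (p v)"
    if uv: "u \<in> V" "v \<in> V" "u \<noteq> v" "E u v" "w \<in> V - {u, v}" for u v w
  proof -
    obtain i j where ij: "i < j" "j < 5" "(i, j) \<noteq> (3, 4)" "{f u, f v} = {i, j}"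
      "closed_segment (p u) (p v) = closed_segment (K5e_point i) (K5e_point j)"
      using ordered[OF uv(1-4)] by blast
    have "f w \<notin> {i, j}" unfolding ij(4)[symmetric] using f_inj uv by auto
    then show ?thesis
      using K5e_point_notin_segment[OF ij(1-3), of "f w"] f5 uv ij(5) by (auto simp: p_def simp del: closed_segment_eq)
  qed
  have cross: "closed_segment (p u) (p v) \<inter> closed_segment (p x) (p y) \<subseteq> p ` ({u, v} \<inter> {x, y})"
    if uv: "u \<in> V" "v \<in> V" "u \<noteq> v" "E u v" and xy: "x \<in> V" "y \<in> V" "x \<noteq> y" "E x y"
      and ne: "{u, v} \<noteq> {x, y}" for u v x y
  proof
    fix w assume w: "w \<in> closed_segment (p u) (p v) \<inter> closed_segment (p x) (p y)"
    obtain i j where ij: "i < j" "j < 5" "(i, j) \<noteq> (3, 4)" "{f u, f v} = {i, j}"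
      "closed_segment (p u) (p v) = closed_segment (K5e_point i) (K5e_point j)"
      using ordered[OF uv] by blast
    obtain k l where kl: "k < l" "l < 5" "(k, l) \<noteq> (3, 4)" "{f x, f y} = {k, l}"
      "closed_segment (p x) (p y) = closed_segment (K5e_point k) (K5e_point l)"
      using ordered[OF xy] by blast
    have "f ` {u, v} \<noteq> f ` {x, y}"
      using inj_on_image_eq_iff[OF idx(1), of "{u, v}" "{x, y}"] ne uv xy by simp
    then have "(i, j) \<noteq> (k, l)" using ij(4) kl(4) by auto
    then have "w \<in> K5e_point ` ({i, j} \<inter> {k, l})"
      using K5e_segments_meet[OF ij(1-3) kl(1-3)] w ij(5) kl(5) by blast
    moreover have "{i, j} \<inter> {k, l} = f ` ({u, v} \<inter> {x, y})"
      using inj_on_image_Int[OF idx(1), of "{u, v}" "{x, y}"] uv xy ij(4) kl(4) by simp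
    ultimately show "w \<in> p ` ({u, v} \<inter> {x, y})"
      by (simp add: p_def image_comp)
  qed
  have arcs: "arc (linepath (p u) (p v))" if "u \<in> V" "v \<in> V" "u \<noteq> v" for u v
    using p_inj that by (intro arc_linepath) (auto simp: inj_on_def)
  show ?thesis
    unfolding planar_graph_def
    \<comment> \<open>Reversing a \<open>linepath\<close> swaps its ends, which gives the required
      symmetry of \<gamma>.\<close>
    by (rule exI[of _ p], rule exI[of _ "\<lambda>u v. linepath (p u) (p v)"])
      (use p_inj arcs avoid cross in simp)
qed



section \<open>Classes of finite groups on arbitrary types\<close>

text \<open>Classes consist of groups on \<open>nat\<close>, so a closure property is transferred to
  other types through such a copy.\<close>

lemma finite_group_nat_copy:
  assumes "group G" "finite (carrier G)"
  obtains H :: "nat monoid" and k where "group H" "finite (carrier H)" "k \<in> iso G H"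
proof -
  obtain f :: "'a \<Rightarrow> nat" where f: "inj_on f (carrier G)"
    using finite_imp_inj_to_nat_seg[OF assms(2)] by blast
  have iso: "f \<in> iso G (image_group f G)"
    by (rule inj_imp_image_group_iso[OF f])
  have "group ((image_group f G)\<lparr>one := f \<one>\<^bsub>G\<^esub>\<rparr>)"
    by (rule group.iso_imp_img_group[OF assms(1) iso])
  then have "group (image_group f G)"
    by (simp add: image_group_def)
  then show thesis
    using that[OF _ _ iso] assms(2) by (simp add: image_group_carrier)
qed

lemma in_class_iso_iff:
  assumes "group G" "group H" "G \<cong> H"
  shows "in_class F G \<longleftrightarrow> in_class F H"
  using assms group.iso_sym iso_trans unfolding in_class_def by metis

text \<open>Closure under images is stated for groups on \<open>nat\<close>. The surjection is
  therefore framed by isomorphisms,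
  \<open>K \<rightarrow> G \<rightarrow> H \<rightarrow> L\<close>, with \<open>K\<close> and
  \<open>L\<close> on \<open>nat\<close>.\<close>

lemma in_class_hom_image:
  assumes "formation F" "group G" "group H" "in_class F G"
    and h: "h \<in> hom G H" "h ` carrier G = carrier H"
  shows "in_class F H"
proof -
  obtain K k where K: "K \<in> F" "k \<in> iso G K"
    using assms(4) unfolding in_class_def is_iso_def by blast
  have gK: "group K" "finite (carrier K)"
    using assms(1) K(1) unfolding formation_def group_class_def by blast+
  have "finite (carrier G)" using iso_finite K gK unfolding is_iso_def by blast
  then have "finite (carrier H)" using h(2) by (metis finite_imageI)
  then obtain L :: "nat monoid" and l where L: "group L" "l \<in> iso H L"
    using finite_group_nat_copy[OF assms(3)] by blast
  obtain k' where k': "k' \<in> iso K G"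
    using group.iso_sym[OF assms(2)] K(2) unfolding is_iso_def by blast
  have "(l \<circ> h) \<circ> k' \<in> hom K L"
    by (intro hom_compose[of _ _ G] hom_compose[of _ _ H]) (use k' L h in \<open>auto simp: iso_def\<close>)
  moreover have "((l \<circ> h) \<circ> k') ` carrier K = carrier L"
    unfolding image_comp[symmetric] using k' L h(2) by (simp add: iso_def bij_betw_def)
  ultimately have "L \<in> F"
    using assms(1) K(1) L(1) unfolding formation_def by blast
  then show ?thesis
    using L unfolding in_class_def is_iso_def by blast
qed

lemma in_class_subgroup:
  assumes "formation F" "hereditary F" "group G" "in_class F G" "subgroup H G"
  shows "in_class F (G\<lparr>carrier := H\<rparr>)"
proof -
  obtain K k where K: "K \<in> F" "k \<in> iso G K"
    using assms(4) unfolding in_class_def is_iso_def by blast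
  have gK: "group K"
    using assms(1) K(1) unfolding formation_def group_class_def by blast
  interpret k: group_hom G K k
    using assms(3) gK K(2) by (simp add: group_hom_def group_hom_axioms_def iso_def)
  have sub: "subgroup (k ` H) K"
    by (rule k.subgroup_img_is_subgroup[OF assms(5)])
  have "in_class F (K\<lparr>carrier := k ` H\<rparr>)"
    using assms(2) K(1) sub unfolding hereditary_def by blast
  moreover have "G\<lparr>carrier := H\<rparr> \<cong> K\<lparr>carrier := k ` H\<rparr>"
    using iso_restrict[OF K(2) assms(3) gK assms(5)] unfolding is_iso_def by blast
  ultimately show ?thesis
    using in_class_iso_iff[OF group.subgroup_imp_group[OF assms(3,5)] group.subgroup_imp_group[OF gK sub]]
    by blast
qed

lemma subgroup_generated_iso:
  assumes "group G" "group H" "k \<in> iso G H" "S \<subseteq> carrier G"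
  shows "subgroup_generated G S \<cong> subgroup_generated H (k ` S)"
proof -
  interpret k: group_hom G H k
    using assms by (simp add: group_hom_def group_hom_axioms_def iso_def)
  have "k ` S \<subseteq> carrier H" using assms(4) by auto
  then have "generate H (carrier H \<inter> k ` S) = k ` generate G (carrier G \<inter> S)"
    using k.generate_img[OF assms(4)] assms(4) by (simp add: Int_absorb1)
  moreover have "subgroup (generate G (carrier G \<inter> S)) G"
    by (simp add: k.G.generate_is_subgroup)
  ultimately show ?thesis
    using iso_restrict[OF assms(3,1,2)] unfolding subgroup_generated_def is_iso_def by fastforce
qed

lemma Gamma_adj_iso:
  assumes "group G" "group H" "k \<in> iso G H" "x \<in> carrier G" "y \<in> carrier G"
  shows "Gamma_adj F H (k x) (k y) \<longleftrightarrow> Gamma_adj F G x y"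
proof -
  have "subgroup_generated G {x, y} \<cong> subgroup_generated H {k x, k y}"
    using subgroup_generated_iso[OF assms(1-3), of "{x, y}"] assms(4,5) by simp
  then show ?thesis
    unfolding Gamma_adj_def
    using in_class_iso_iff[OF group.group_subgroup_generated[OF assms(1)] group.group_subgroup_generated[OF assms(2)]]
    by blast
qed

lemma I_F_alt: "I_F F G = {x \<in> carrier G. \<forall>g\<in>carrier G. \<not> Gamma_adj F G x g}"
  unfolding I_F_def Gamma_adj_def by auto

lemma Gamma_adj_commute: "Gamma_adj F G x y \<longleftrightarrow> Gamma_adj F G y x"
  by (simp add: Gamma_adj_def insert_commute)

lemma I_F_subgroup:
  assumes "semiregular F" "group G" "finite (carrier G)"
  shows "subgroup (I_F F G) G"
proof -
  obtain H :: "nat monoid" and k where H: "group H" "finite (carrier H)" and k: "k \<in> iso G H"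
    using finite_group_nat_copy[OF assms(2,3)] .
  interpret k: group_hom G H k
    using assms(2) H(1) k by (simp add: group_hom_def group_hom_axioms_def iso_def)
  have sub: "subgroup (I_F F H) H"
    using assms(1) H unfolding semiregular_def by blast
  have im: "carrier H = k ` carrier G" using k by (auto simp: iso_def bij_betw_def)
  \<comment> \<open>Isomorphisms preserve adjacency, so \<open>I_F F G\<close> is the preimage of
    the subgroup obtained on \<open>nat\<close>.\<close>
  have eq: "I_F F G = {x \<in> carrier G. k x \<in> I_F F H}"
    unfolding I_F_alt im using Gamma_adj_iso[OF assms(2) H(1) k] by auto
  show ?thesis
    unfolding eq using subgroup.m_closed[OF sub] subgroup.one_closed[OF sub] subgroup.m_inv_closed[OF sub]
    by (unfold_locales) auto
qed

lemma two_recognizable_in_class: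
  assumes "two_recognizable F" "group G" "finite (carrier G)"
    and "\<And>x y. x \<in> carrier G \<Longrightarrow> y \<in> carrier G \<Longrightarrow> \<not> Gamma_adj F G x y"
  shows "in_class F G"
proof -
  obtain H :: "nat monoid" and k where H: "group H" "finite (carrier H)" and k: "k \<in> iso G H"
    using finite_group_nat_copy[OF assms(2,3)] .
  have im: "carrier H = k ` carrier G" using k by (auto simp: iso_def bij_betw_def)
  have "\<forall>x\<in>carrier H. \<forall>y\<in>carrier H. in_class F (subgroup_generated H {x, y})"
    using assms(4) Gamma_adj_iso[OF assms(2) H(1) k] unfolding im Gamma_adj_def by auto
  then have "H \<in> F" using assms(1) H unfolding two_recognizable_def by blast
  then show ?thesis using k unfolding in_class_def is_iso_def by blast
qed

lemma in_class_no_Gamma_adj: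
  assumes "formation F" "hereditary F" "group G" "in_class F G" "x \<in> carrier G" "y \<in> carrier G"
  shows "\<not> Gamma_adj F G x y"
  unfolding Gamma_adj_def subgroup_generated_def
  using in_class_subgroup[OF assms(1-4)] group.generate_is_subgroup[OF assms(3)] by auto

text \<open>By heredity, if \<langle>x', y'\<rangle> were in the class, so would be its subgroup
  \<langle>x, y\<rangle>. Most further edges are obtained from a given one in this way.\<close>

lemma Gamma_adj_mono:
  assumes "formation F" "hereditary F" "group G" "Gamma_adj F G x y"
    and c: "x' \<in> carrier G" "y' \<in> carrier G"
    and "x \<in> generate G {x', y'}" "y \<in> generate G {x', y'}"
  shows "Gamma_adj F G x' y'"
proof -
  interpret group G by fact
  let ?K = "generate G {x', y'}"
  have K: "subgroup ?K G" using c by (intro generate_is_subgroup) simp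
  have gK: "group (G\<lparr>carrier := ?K\<rparr>)" using subgroup_imp_group[OF K] .
  have xy: "x \<in> carrier G" "y \<in> carrier G" using subgroup.mem_carrier[OF K] assms by blast+
  have L: "generate G {x, y} \<subseteq> ?K"
    by (rule generate_subgroup_incl[OF _ K]) (use assms in simp)
  have "subgroup (generate G {x, y}) (G\<lparr>carrier := ?K\<rparr>)"
    using subgroup_incl[OF generate_is_subgroup K L] xy by simp
  then show ?thesis
    using assms(4) in_class_subgroup[OF assms(1,2) gK] xy c
    unfolding Gamma_adj_def subgroup_generated_def by (auto simp: Int_absorb1)
qed

lemma Gamma_adj_subgroup:
  assumes "group G" "subgroup K G" "x \<in> K" "y \<in> K"
  shows "Gamma_adj F (G\<lparr>carrier := K\<rparr>) x y \<longleftrightarrow> Gamma_adj F G x y"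
proof -
  have "generate (G\<lparr>carrier := K\<rparr>) {x, y} = generate G {x, y}"
    by (rule group.generate_consistent[OF assms(1) _ assms(2)]) (use assms in simp)
  moreover have "carrier G \<inter> {x, y} = {x, y}" "K \<inter> {x, y} = {x, y}"
    using assms(3,4) subgroup.subset[OF assms(2)] by blast+
  ultimately show ?thesis
    by (simp add: Gamma_adj_def subgroup_generated_def)
qed

section \<open>Nilpotent groups of class at most 2\<close>

lemma (in group) l_inv_assoc: "a \<in> carrier G \<Longrightarrow> b \<in> carrier G \<Longrightarrow> inv a \<otimes> (a \<otimes> b) = b"
  by (simp add: m_assoc[symmetric])

lemma (in group) r_inv_assoc: "a \<in> carrier G \<Longrightarrow> b \<in> carrier G \<Longrightarrow> a \<otimes> (inv a \<otimes> b) = b"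
  by (simp add: m_assoc[symmetric])

lemma (in group) commute_inv:
  assumes "a \<in> carrier G" "c \<in> carrier G" "a \<otimes> c = c \<otimes> a"
  shows "inv a \<otimes> c = c \<otimes> inv a"
proof -
  have "inv a \<otimes> c = inv a \<otimes> (c \<otimes> a) \<otimes> inv a" using assms(1,2) by (simp add: m_assoc)
  also have "\<dots> = c \<otimes> inv a" unfolding assms(3)[symmetric] using assms(1,2) by (simp add: l_inv_assoc)
  finally show ?thesis .
qed

lemma (in group) commute_mult:
  assumes "a \<in> carrier G" "b \<in> carrier G" "c \<in> carrier G" "a \<otimes> c = c \<otimes> a" "b \<otimes> c = c \<otimes> b"
  shows "a \<otimes> b \<otimes> c = c \<otimes> (a \<otimes> b)"
  using assms by (metis m_assoc)

lemma (in group) center_subgroup: "subgroup {z \<in> carrier G. \<forall>c\<in>carrier G. z \<otimes> c = c \<otimes> z} G"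
proof (rule subgroupI)
  show "inv a \<in> {z \<in> carrier G. \<forall>c\<in>carrier G. z \<otimes> c = c \<otimes> z}"
    if "a \<in> {z \<in> carrier G. \<forall>c\<in>carrier G. z \<otimes> c = c \<otimes> z}" for a
    using that commute_inv[of a] inv_closed by blast
  show "a \<otimes> b \<in> {z \<in> carrier G. \<forall>c\<in>carrier G. z \<otimes> c = c \<otimes> z}"
    if "a \<in> {z \<in> carrier G. \<forall>c\<in>carrier G. z \<otimes> c = c \<otimes> z}"
      "b \<in> {z \<in> carrier G. \<forall>c\<in>carrier G. z \<otimes> c = c \<otimes> z}" for a b
    using that commute_mult[of a b] m_closed by blast
qed auto

text \<open>The first term of the lower central series after \<open>G\<close> is central, so the
  next one is trivial.\<close>

lemma (in group) commutators_central_imp_nilpotent: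
  assumes "\<And>a b c. a \<in> carrier G \<Longrightarrow> b \<in> carrier G \<Longrightarrow> c \<in> carrier G \<Longrightarrow>
      a \<otimes> b \<otimes> inv a \<otimes> inv b \<otimes> c = c \<otimes> (a \<otimes> b \<otimes> inv a \<otimes> inv b)"
  shows "nilpotent_group G"
proof -
  define Z where "Z = {z \<in> carrier G. \<forall>c\<in>carrier G. z \<otimes> c = c \<otimes> z}"
  have Z: "subgroup Z G" unfolding Z_def by (rule center_subgroup)
  have "lower_central G 1 \<subseteq> Z"
    unfolding One_nat_def lower_central.simps commutator_subgroup_def
    by (rule generate_subgroup_incl[OF _ Z]) (use assms in \<open>auto simp: Z_def\<close>)
  then have comm: "h \<in> carrier G \<and> h \<otimes> k = k \<otimes> h" if "h \<in> lower_central G 1" "k \<in> carrier G" for h k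
    using that unfolding Z_def by blast
  have "h \<otimes> k \<otimes> inv h \<otimes> inv k = \<one>" if hk: "h \<in> lower_central G 1" "k \<in> carrier G" for h k
  proof -
    have h: "h \<in> carrier G" "h \<otimes> k = k \<otimes> h" using comm[OF hk] by blast+
    show ?thesis unfolding h(2) using h(1) hk(2) by (simp add: m_assoc r_inv_assoc)
  qed
  then have "{h \<otimes> k \<otimes> inv h \<otimes> inv k | h k. h \<in> lower_central G 1 \<and> k \<in> carrier G} \<subseteq> {\<one>}"
    by blast
  then have "lower_central G (Suc 1) \<subseteq> {\<one>}"
    unfolding lower_central.simps(2) commutator_subgroup_def
    using generate_subgroup_incl[OF _ triv_subgroup] by simp
  moreover have "\<one> \<in> lower_central G (Suc 1)"
    unfolding lower_central.simps(2) commutator_subgroup_def by (rule generate.one)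
  ultimately have "lower_central G (Suc 1) = {\<one>}" by blast
  then show ?thesis unfolding nilpotent_group_def using group_axioms by blast
qed

lemma in_class_commutators_central:
  assumes "contains_nilpotent F" "group G" "finite (carrier G)"
    and central: "\<And>a b c. a \<in> carrier G \<Longrightarrow> b \<in> carrier G \<Longrightarrow> c \<in> carrier G \<Longrightarrow>
      a \<otimes>\<^bsub>G\<^esub> b \<otimes>\<^bsub>G\<^esub> inv\<^bsub>G\<^esub> a \<otimes>\<^bsub>G\<^esub> inv\<^bsub>G\<^esub> b \<otimes>\<^bsub>G\<^esub> c = c \<otimes>\<^bsub>G\<^esub> (a \<otimes>\<^bsub>G\<^esub> b \<otimes>\<^bsub>G\<^esub> inv\<^bsub>G\<^esub> a \<otimes>\<^bsub>G\<^esub> inv\<^bsub>G\<^esub> b)"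
  shows "in_class F G"
proof -
  obtain H :: "nat monoid" and k where H: "group H" "finite (carrier H)" and k: "k \<in> iso G H"
    using finite_group_nat_copy[OF assms(2,3)] .
  interpret k: group_hom G H k
    using assms(2) H(1) k by (simp add: group_hom_def group_hom_axioms_def iso_def)
  have im: "carrier H = k ` carrier G" using k by (auto simp: iso_def bij_betw_def)
  have "nilpotent_group H"
  proof (rule group.commutators_central_imp_nilpotent[OF H(1)])
    fix a b c assume "a \<in> carrier H" "b \<in> carrier H" "c \<in> carrier H"
    then obtain a' b' c' where "a = k a'" "b = k b'" "c = k c'"
      "a' \<in> carrier G" "b' \<in> carrier G" "c' \<in> carrier G" unfolding im by blast
    then show "a \<otimes>\<^bsub>H\<^esub> b \<otimes>\<^bsub>H\<^esub> inv\<^bsub>H\<^esub> a \<otimes>\<^bsub>H\<^esub> inv\<^bsub>H\<^esub> b \<otimes>\<^bsub>H\<^esub> c = c \<otimes>\<^bsub>H\<^esub> (a \<otimes>\<^bsub>H\<^esub> b \<otimes>\<^bsub>H\<^esub> inv\<^bsub>H\<^esub> a \<otimes>\<^bsub>H\<^esub> inv\<^bsub>H\<^esub> b)"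
      using arg_cong[OF central[of a' b' c'], of k] by simp
  qed
  then have "H \<in> F" using assms(1) H unfolding contains_nilpotent_def by blast
  then show ?thesis using k unfolding in_class_def is_iso_def by blast
qed



lemma (in group) commute_generate:
  assumes "g \<in> generate G S" "S \<subseteq> carrier G" "c \<in> carrier G" "\<And>s. s \<in> S \<Longrightarrow> s \<otimes> c = c \<otimes> s"
  shows "g \<otimes> c = c \<otimes> g"
  using assms(1)
proof induction
  case one
  then show ?case using assms(3) by simp
next
  case (incl h)
  then show ?case using assms(4) by blast
next
  case (inv h)
  then show ?case using commute_inv assms(2-4) by blast
next
  case (eng h k)
  then show ?case using commute_mult[of h k c] generate_incl[OF assms(2)] assms(3) by blast
qed

text \<open>The elements that commute with \<open>g\<close> modulo the central subgroup
  \<open>Z\<close> form a subgroup, so testing generators is enough.\<close>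

lemma (in group) commute_mod_center_generate:
  assumes "k \<in> generate G S" "S \<subseteq> carrier G" "g \<in> carrier G" and Z: "subgroup Z G"
    and central: "\<And>z c. z \<in> Z \<Longrightarrow> c \<in> carrier G \<Longrightarrow> z \<otimes> c = c \<otimes> z"
    and S: "\<And>s. s \<in> S \<Longrightarrow> \<exists>z\<in>Z. g \<otimes> s = z \<otimes> (s \<otimes> g)"
  shows "\<exists>z\<in>Z. g \<otimes> k = z \<otimes> (k \<otimes> g)"
  using assms(1)
proof induction
  case one
  then show ?case using subgroup.one_closed[OF Z] assms(3) by (intro bexI[of _ \<one>]) simp_all
next
  case (incl h)
  then show ?case using S by blast
next
  case (inv h)
  then obtain z where z: "z \<in> Z" "g \<otimes> h = z \<otimes> (h \<otimes> g)" using S by blast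
  have c: "h \<in> carrier G" "z \<in> carrier G" "g \<in> carrier G"
    using inv assms(2,3) subgroup.mem_carrier[OF Z z(1)] by auto
  have "inv h \<otimes> (g \<otimes> h) \<otimes> inv h = inv h \<otimes> (z \<otimes> (h \<otimes> g)) \<otimes> inv h" using z(2) by simp
  then have "inv h \<otimes> g = inv h \<otimes> z \<otimes> (h \<otimes> g) \<otimes> inv h" using c by (simp add: m_assoc)
  also have "\<dots> = z \<otimes> inv h \<otimes> (h \<otimes> g) \<otimes> inv h" using central[of z "inv h"] z c by simp
  also have "\<dots> = z \<otimes> (g \<otimes> inv h)" using c by (simp add: m_assoc l_inv_assoc)
  finally have "inv z \<otimes> (inv h \<otimes> g) = g \<otimes> inv h" using c by (simp add: l_inv_assoc)
  then show ?case using subgroup.m_inv_closed[OF Z z(1)] by metis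
next
  case (eng h k)
  then obtain z z' where z: "z \<in> Z" "g \<otimes> h = z \<otimes> (h \<otimes> g)" "z' \<in> Z" "g \<otimes> k = z' \<otimes> (k \<otimes> g)" by blast
  have c: "h \<in> carrier G" "k \<in> carrier G" "z \<in> carrier G" "z' \<in> carrier G" "g \<in> carrier G"
    using eng assms(2,3) subgroup.mem_carrier[OF Z z(1)] subgroup.mem_carrier[OF Z z(3)] generate_incl[OF assms(2)] by auto
  have "g \<otimes> (h \<otimes> k) = z \<otimes> h \<otimes> (g \<otimes> k)" using c z(2) by (simp add: m_assoc[symmetric])
  also have "\<dots> = z \<otimes> (h \<otimes> z') \<otimes> (k \<otimes> g)" unfolding z(4) using c by (simp add: m_assoc)
  also have "\<dots> = z \<otimes> z' \<otimes> (h \<otimes> k \<otimes> g)" unfolding central[OF z(3) c(1), symmetric] using c by (simp add: m_assoc)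
  finally show ?case using subgroup.m_closed[OF Z z(1,3)] by blast
qed

text \<open>\<open>d\<close> is the commutator of \<open>x\<close> and \<open>y\<close>. It commutes
  with both, hence is central; so the generators commute modulo the center, and then any two
  elements do.\<close>

lemma (in group) commutators_central_of_generators:
  assumes gen: "carrier G = generate G {x, y}" and c: "x \<in> carrier G" "y \<in> carrier G" "d \<in> carrier G"
    and d: "x \<otimes> y = d \<otimes> (y \<otimes> x)" "x \<otimes> d = d \<otimes> x" "y \<otimes> d = d \<otimes> y"
    and abc: "a \<in> carrier G" "b \<in> carrier G" "e \<in> carrier G"
  shows "a \<otimes> b \<otimes> inv a \<otimes> inv b \<otimes> e = e \<otimes> (a \<otimes> b \<otimes> inv a \<otimes> inv b)"
proof -
  define Z where "Z = {z \<in> carrier G. \<forall>c\<in>carrier G. z \<otimes> c = c \<otimes> z}"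
  have Z: "subgroup Z G" unfolding Z_def by (rule center_subgroup)
  have central: "z \<otimes> c = c \<otimes> z" if "z \<in> Z" "c \<in> carrier G" for z c using that unfolding Z_def by blast
  have dcomm: "d \<otimes> g = g \<otimes> d" if "g \<in> carrier G" for g
    by (rule commute_generate[where S = "{x, y}", symmetric]) (use that gen c d in auto)
  have dZ: "d \<in> Z"
    unfolding Z_def using dcomm c(3) by blast
  define com where "com g k \<longleftrightarrow> (\<exists>z\<in>Z. g \<otimes> k = z \<otimes> (k \<otimes> g))" for g k
  have com_refl: "com g g" if "g \<in> carrier G" for g
    unfolding com_def using subgroup.one_closed[OF Z] that by (intro bexI[of _ \<one>]) simp_all
  have com_sym: "com k g" if gk: "com g k" "g \<in> carrier G" "k \<in> carrier G" for g k
  proof -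
    obtain z where z: "z \<in> Z" "g \<otimes> k = z \<otimes> (k \<otimes> g)" using gk(1) unfolding com_def by blast
    have "inv z \<otimes> (g \<otimes> k) = k \<otimes> g"
      unfolding z(2) using subgroup.mem_carrier[OF Z z(1)] gk(2,3) by (simp add: l_inv_assoc)
    then show ?thesis unfolding com_def using subgroup.m_inv_closed[OF Z z(1)] by metis
  qed
  have com_gen: "com g k" if "com g x" "com g y" "g \<in> carrier G" "k \<in> carrier G" for g k
    unfolding com_def
    by (rule commute_mod_center_generate[where S = "{x, y}", OF _ _ that(3) Z central])
      (use that gen c in \<open>auto simp: com_def\<close>)
  \<comment> \<open>Commutation modulo \<open>Z\<close> spreads from the pair \<open>x\<close>,
    \<open>y\<close> to a generator and any element, and from there to any two elements.\<close>
  have xy: "com x y" unfolding com_def using dZ d(1) by blast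
  have "com k x" "com k y" if "k \<in> carrier G" for k
    using com_gen com_sym com_refl xy c that by blast+
  then have "com a b" using com_gen abc by blast
  then obtain z where z: "z \<in> Z" "a \<otimes> b = z \<otimes> (b \<otimes> a)" unfolding com_def by blast
  have "a \<otimes> b \<otimes> inv a \<otimes> inv b = z"
    unfolding z(2) using subgroup.mem_carrier[OF Z z(1)] abc by (simp add: m_assoc r_inv_assoc)
  then show ?thesis using central[OF z(1) abc(3)] by simp
qed

text \<open>The test for non-adjacency used below: the commutator \<open>d\<close> is central in
  \<langle>x, y\<rangle>, which is therefore nilpotent and in the class.\<close>

lemma (in group) Gamma_adj_class2:
  assumes "contains_nilpotent F" "finite (carrier G)"
    and xy: "x \<in> carrier G" "y \<in> carrier G"
    and d: "d \<in> generate G {x, y}" "x \<otimes> y = d \<otimes> (y \<otimes> x)" "x \<otimes> d = d \<otimes> x" "y \<otimes> d = d \<otimes> y"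
  shows "\<not> Gamma_adj F G x y"
proof -
  let ?K = "subgroup_generated G {x, y}"
  have int: "carrier G \<inter> {x, y} = {x, y}" using xy by auto
  have carr: "carrier ?K = generate G {x, y}" by (simp add: carrier_subgroup_generated int)
  have xyK: "x \<in> carrier ?K" "y \<in> carrier ?K" unfolding carr by (auto intro: generate.incl)
  then have int': "carrier ?K \<inter> {x, y} = {x, y}" by auto
  have "carrier (subgroup_generated ?K {x, y}) = generate ?K {x, y}"
    by (simp only: carrier_subgroup_generated[of ?K] int')
  then have gen: "carrier ?K = generate ?K {x, y}" by simp
  have fin: "finite (carrier ?K)"
    using finite_subset[OF carrier_subgroup_generated_subset assms(2)] .
  interpret K: group ?K by simp
  have "in_class F ?K"
  proof (rule in_class_commutators_central[OF assms(1) K.group_axioms fin])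
    have mult: "mult ?K = mult G" by (simp add: subgroup_generated_def)
    show "a \<otimes>\<^bsub>?K\<^esub> b \<otimes>\<^bsub>?K\<^esub> inv\<^bsub>?K\<^esub> a \<otimes>\<^bsub>?K\<^esub> inv\<^bsub>?K\<^esub> b \<otimes>\<^bsub>?K\<^esub> c = c \<otimes>\<^bsub>?K\<^esub> (a \<otimes>\<^bsub>?K\<^esub> b \<otimes>\<^bsub>?K\<^esub> inv\<^bsub>?K\<^esub> a \<otimes>\<^bsub>?K\<^esub> inv\<^bsub>?K\<^esub> b)"
      if "a \<in> carrier ?K" "b \<in> carrier ?K" "c \<in> carrier ?K" for a b c
      by (rule K.commutators_central_of_generators[OF gen xyK _ _ _ _ that, of d])
        (use d carr in \<open>simp_all only: mult\<close>)
  qed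
  then show ?thesis unfolding Gamma_adj_def by simp
qed

lemma (in group) Gamma_adj_not_commute:
  assumes "contains_nilpotent F" "finite (carrier G)" "x \<in> carrier G" "y \<in> carrier G" "x \<otimes> y = y \<otimes> x"
  shows "\<not> Gamma_adj F G x y"
  by (rule Gamma_adj_class2[OF assms(1-4), of \<one>]) (use assms in \<open>auto intro: generate.one\<close>)

section \<open>Generating pairs of the symmetric group of degree 3\<close>

text \<open>The defining relations of \<open>S\<^sub>3\<close>, written as products so that they can
  serve as rewrite rules. The condition \<open>x \<noteq> \<one>\<close> ensures that \<langle>x,
  y\<rangle> is all of \<open>S\<^sub>3\<close>, because every nontrivial normal subgroup of
  \<open>S\<^sub>3\<close> contains the 3-cycles.\<close>

definition s3_pair :: "('a, 'b) monoid_scheme \<Rightarrow> 'a \<Rightarrow> 'a \<Rightarrow> bool" where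
  "s3_pair G x y \<longleftrightarrow> x \<in> carrier G \<and> y \<in> carrier G \<and> x \<noteq> \<one>\<^bsub>G\<^esub> \<and>
     x \<otimes>\<^bsub>G\<^esub> (x \<otimes>\<^bsub>G\<^esub> x) = \<one>\<^bsub>G\<^esub> \<and> y \<otimes>\<^bsub>G\<^esub> y = \<one>\<^bsub>G\<^esub> \<and> y \<otimes>\<^bsub>G\<^esub> x = x \<otimes>\<^bsub>G\<^esub> (x \<otimes>\<^bsub>G\<^esub> y)"

definition s3_word :: "('a, 'b) monoid_scheme \<Rightarrow> 'a \<Rightarrow> 'a \<Rightarrow> nat \<times> nat \<Rightarrow> 'a" where
  "s3_word G x y = (\<lambda>(i, j). (x [^]\<^bsub>G\<^esub> i) \<otimes>\<^bsub>G\<^esub> (y [^]\<^bsub>G\<^esub> j))"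

text \<open>Multiplication of the exponent pairs of \<open>s3_word\<close>. Moving \<open>y\<close>
  past a power of \<open>x\<close> doubles the exponent, which is negation modulo 3 within the
  natural numbers.\<close>

definition s3_mult :: "nat \<times> nat \<Rightarrow> nat \<times> nat \<Rightarrow> nat \<times> nat" where
  "s3_mult = (\<lambda>(i, j) (k, l). ((i + (if j = 0 then k else 2 * k)) mod 3, (j + l) mod 2))"

abbreviation s3_index :: "(nat \<times> nat) set" where
  "s3_index \<equiv> {..<3} \<times> {..<2}"

lemma s3_mult_closed: "s3_mult p q \<in> s3_index"
  by (cases p; cases q) (simp add: s3_mult_def)

context group begin

lemma s3_pair_pow:
  assumes "s3_pair G x y"
  shows "x [^] (n mod 3 :: nat) = x [^] n" "y [^] (m mod 2 :: nat) = y [^] m"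
    and "y \<otimes> x [^] n = x [^] (2 * n) \<otimes> y"
proof -
  have c: "x \<in> carrier G" "y \<in> carrier G" using assms by (auto simp: s3_pair_def)
  have x3: "x [^] (3::nat) = \<one>" using assms by (simp add: s3_pair_def numeral_3_eq_3 m_assoc)
  have y2: "y [^] (2::nat) = \<one>" using assms by (simp add: s3_pair_def numeral_2_eq_2)
  have "x [^] n = x [^] (3 * (n div 3) + n mod 3)" by simp
  also have "\<dots> = x [^] (n mod 3)"
    using c x3 by (simp only: nat_pow_mult[symmetric] nat_pow_pow[symmetric]) (simp add: nat_pow_one)
  finally show "x [^] (n mod 3) = x [^] n" by simp
  have "y [^] m = y [^] (2 * (m div 2) + m mod 2)" by simp
  also have "\<dots> = y [^] (m mod 2)"
    using c y2 by (simp only: nat_pow_mult[symmetric] nat_pow_pow[symmetric]) (simp add: nat_pow_one)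
  finally show "y [^] (m mod 2) = y [^] m" by simp
  show "y \<otimes> x [^] n = x [^] (2 * n) \<otimes> y"
  proof (induction n)
    case (Suc n)
    have "y \<otimes> x [^] Suc n = x [^] (2 * n) \<otimes> (y \<otimes> x)"
      using Suc c by (simp add: m_assoc[symmetric])
    also have "\<dots> = x [^] (2 * n) \<otimes> (x \<otimes> (x \<otimes> y))" using assms by (simp add: s3_pair_def)
    also have "\<dots> = x [^] (2 * Suc n) \<otimes> y" using c by (simp add: m_assoc)
    finally show ?case .
  qed (use c in simp)
qed

text \<open>The table \<open>s3_mult\<close> does not refer to the group, so words multiply alike in
  any two groups; \<open>s3_pair_iso\<close> rests on this.\<close>

lemma s3_word_mult:
  assumes "s3_pair G x y" "p \<in> s3_index" "q \<in> s3_index"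
  shows "s3_word G x y (s3_mult p q) = s3_word G x y p \<otimes> s3_word G x y q"
proof -
  obtain i j k l where pq: "p = (i, j)" "q = (k, l)" by fastforce
  have c: "x \<in> carrier G" "y \<in> carrier G" using assms by (auto simp: s3_pair_def)
  have j: "j = 0 \<or> j = 1" using assms pq by auto
  have "x [^] i \<otimes> y [^] j \<otimes> (x [^] k \<otimes> y [^] l) = x [^] i \<otimes> ((y [^] j \<otimes> x [^] k) \<otimes> y [^] l)"
    using c by (simp add: m_assoc)
  also have "y [^] j \<otimes> x [^] k = x [^] (if j = 0 then k else 2 * k) \<otimes> y [^] j"
    using j s3_pair_pow(3)[OF assms(1), of k] c by auto
  finally show ?thesis
    unfolding pq s3_word_def s3_mult_def
    using c by (simp add: s3_pair_pow(1,2)[OF assms(1)] nat_pow_mult[symmetric] m_assoc)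
qed

lemma s3_pair_generate:
  assumes "s3_pair G x y"
  shows "generate G {x, y} = s3_word G x y ` s3_index"
proof
  have c: "x \<in> carrier G" "y \<in> carrier G" using assms by (auto simp: s3_pair_def)
  have s: "subgroup (generate G {x, y}) G" by (rule generate_is_subgroup) (use c in auto)
  have xy: "x \<in> generate G {x, y}" "y \<in> generate G {x, y}" by (auto intro: generate.incl)
  have pow: "a [^] (n::nat) \<in> generate G {x, y}" if "a \<in> generate G {x, y}" for a n
    by (induction n) (use that in \<open>auto intro: generate.one generate.eng\<close>)
  show "s3_word G x y ` s3_index \<subseteq> generate G {x, y}"
    unfolding s3_word_def using pow[OF xy(1)] pow[OF xy(2)] by (auto intro: generate.eng)
  have x_word: "x = s3_word G x y (1, 0)" "y = s3_word G x y (0, 1)" "\<one> = s3_word G x y (0, 0)"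
    "inv x = s3_word G x y (2, 0)"
    using c assms inv_equality[of "x \<otimes> x" x]
    by (simp_all add: s3_word_def s3_pair_def numeral_2_eq_2 m_assoc)
  have y_inv: "inv y = y" using assms inv_equality[of y y] by (simp add: s3_pair_def)
  have mem: "\<one> \<in> s3_word G x y ` s3_index" "x \<in> s3_word G x y ` s3_index"
    "y \<in> s3_word G x y ` s3_index" "inv x \<in> s3_word G x y ` s3_index"
    using imageI[of "(0, 0)" s3_index "s3_word G x y"] imageI[of "(1, 0)" s3_index "s3_word G x y"]
      imageI[of "(0, 1)" s3_index "s3_word G x y"] imageI[of "(2, 0)" s3_index "s3_word G x y"]
    unfolding x_word[symmetric] by simp_all
  show "generate G {x, y} \<subseteq> s3_word G x y ` s3_index"
  proof
    fix g assume "g \<in> generate G {x, y}"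
    then show "g \<in> s3_word G x y ` s3_index"
    proof induction
      case (eng h k)
      then obtain p q where "p \<in> s3_index" "q \<in> s3_index" "h = s3_word G x y p" "k = s3_word G x y q" by blast
      then show ?case using s3_word_mult[OF assms] s3_mult_closed by (metis image_eqI)
    qed (use mem y_inv in auto)
  qed
qed

text \<open>\<open>x\<close> and \<open>y\<close> do not commute, so \<open>y\<close> is not a power
  of \<open>x\<close>; the other inequalities follow by cancellation.\<close>

lemma s3_word_inj:
  assumes "s3_pair G x y"
  shows "inj_on (s3_word G x y) s3_index"
proof -
  have c: "x \<in> carrier G" "y \<in> carrier G" using assms by (auto simp: s3_pair_def)
  have rel: "x \<noteq> \<one>" "x \<otimes> (x \<otimes> x) = \<one>" "y \<otimes> y = \<one>" "y \<otimes> x = x \<otimes> (x \<otimes> y)"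
    using assms by (auto simp: s3_pair_def)
  have ncomm: "y \<otimes> x \<noteq> x \<otimes> y"
  proof
    assume "y \<otimes> x = x \<otimes> y"
    then have "x \<otimes> (x \<otimes> y) = x \<otimes> y" using rel(4) by simp
    then show False using rel(1) c by simp
  qed
  have d1: "x \<otimes> x \<noteq> \<one>" "x \<otimes> x \<noteq> x" using rel(1,2) c by auto
  have d2: "y \<noteq> \<one>" "y \<noteq> x" "y \<noteq> x \<otimes> x" using ncomm c by (auto simp: m_assoc)
  have d3: "x \<otimes> y \<noteq> \<one>" "x \<otimes> y \<noteq> x" "x \<otimes> y \<noteq> x \<otimes> x" "x \<otimes> y \<noteq> y"
    using d2 c rel inv_equality[of x y] by (auto simp: rel(1))
  have d4: "x \<otimes> (x \<otimes> y) \<noteq> \<one>" "x \<otimes> (x \<otimes> y) \<noteq> x" "x \<otimes> (x \<otimes> y) \<noteq> x \<otimes> x"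
    "x \<otimes> (x \<otimes> y) \<noteq> y" "x \<otimes> (x \<otimes> y) \<noteq> x \<otimes> y"
  proof -
    show "x \<otimes> (x \<otimes> y) \<noteq> \<one>" unfolding rel(2)[symmetric] using d3(3) c by simp
    have "x \<otimes> (x \<otimes> y) = x \<otimes> x \<otimes> y" using c by (simp add: m_assoc)
    then show "x \<otimes> (x \<otimes> y) \<noteq> y" using d1(1) c by simp
  qed (use d3 c in simp_all)
  have idx: "s3_index = {(0,0),(1,0),(2,0),(0,1),(1,1),(2,1)}" by (auto simp: numeral_2_eq_2 numeral_3_eq_3 less_Suc_eq)
  show ?thesis
    unfolding idx using d1 d2 d3 d4 rel(1) c
    by (simp add: s3_word_def numeral_2_eq_2 m_assoc)
qed

end

lemma s3_pair_iso:
  assumes "group G" "group H" "s3_pair G x y" "s3_pair H u v"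
  shows "subgroup_generated G {x, y} \<cong> subgroup_generated H {u, v}"
proof -
  define f where "f = s3_word G x y"
  define g where "g = s3_word H u v"
  \<comment> \<open>Reads off the exponents of a word in \<open>x\<close>, \<open>y\<close> and
    evaluates them at \<open>u\<close>, \<open>v\<close>.\<close>
  define \<phi> where "\<phi> = g \<circ> the_inv_into s3_index f"
  have inj: "inj_on f s3_index" "inj_on g s3_index"
    unfolding f_def g_def using group.s3_word_inj[OF assms(1,3)] group.s3_word_inj[OF assms(2,4)] by simp_all
  have carr: "carrier (subgroup_generated G {x, y}) = f ` s3_index" "carrier (subgroup_generated H {u, v}) = g ` s3_index"
    unfolding f_def g_def
    using group.s3_pair_generate[OF assms(1,3)] group.s3_pair_generate[OF assms(2,4)] assms(3,4)
    by (simp_all add: carrier_subgroup_generated s3_pair_def)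
  have \<phi>: "\<phi> (f p) = g p" if "p \<in> s3_index" for p
    unfolding \<phi>_def using the_inv_into_f_f[OF inj(1) that] by simp
  have "\<phi> \<in> iso (subgroup_generated G {x, y}) (subgroup_generated H {u, v})"
  proof (rule isoI)
    show "\<phi> \<in> hom (subgroup_generated G {x, y}) (subgroup_generated H {u, v})"
    proof (rule homI)
      fix a assume "a \<in> carrier (subgroup_generated G {x, y})"
      then show "\<phi> a \<in> carrier (subgroup_generated H {u, v})" unfolding carr using \<phi> by auto
    next
      fix a b assume "a \<in> carrier (subgroup_generated G {x, y})" "b \<in> carrier (subgroup_generated G {x, y})"
      then obtain p q where pq: "p \<in> s3_index" "q \<in> s3_index" "a = f p" "b = f q" unfolding carr by blast
      have "\<phi> (f p \<otimes>\<^bsub>G\<^esub> f q) = g p \<otimes>\<^bsub>H\<^esub> g q"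
        using group.s3_word_mult[OF assms(1,3) pq(1,2)] group.s3_word_mult[OF assms(2,4) pq(1,2)]
          \<phi>[OF s3_mult_closed[of p q]] unfolding f_def g_def by simp
      then show "\<phi> (a \<otimes>\<^bsub>subgroup_generated G {x, y}\<^esub> b) = \<phi> a \<otimes>\<^bsub>subgroup_generated H {u, v}\<^esub> \<phi> b"
        using pq \<phi> by (simp add: subgroup_generated_def)
    qed
    have "bij_betw (g \<circ> the_inv_into s3_index f) (f ` s3_index) (g ` s3_index)"
      using inj by (intro bij_betw_trans[OF bij_betw_the_inv_into]) (auto simp: bij_betw_def)
    then show "bij_betw \<phi> (carrier (subgroup_generated G {x, y})) (carrier (subgroup_generated H {u, v}))"
      unfolding carr \<phi>_def .
  qed
  then show ?thesis unfolding is_iso_def by blast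
qed

lemma (in group) card_s3_pair_generate:
  assumes "s3_pair G x y"
  shows "card (generate G {x, y}) = 6"
  using card_image[OF s3_word_inj[OF assms]] s3_pair_generate[OF assms] by simp

lemma sym_group_3_pair:
  obtains x y where "s3_pair (sym_group 3) x y" "subgroup_generated (sym_group 3) {x, y} = sym_group 3"
proof -
  interpret S: group "sym_group 3" by (rule sym_group_is_group)
  define y :: "nat \<Rightarrow> nat" where "y = Transposition.transpose 1 2"
  define x :: "nat \<Rightarrow> nat" where "x = Transposition.transpose 1 2 \<circ> Transposition.transpose 2 3"
  have perm: "y permutes {1..3}" "x permutes {1..3}"
    unfolding x_def y_def by (auto intro!: permutes_compose permutes_swap_id)
  have xy: "s3_pair (sym_group 3) x y"
    unfolding s3_pair_def sym_group_carrier sym_group_mult sym_group_one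
  proof (intro conjI perm)
    show "x \<noteq> id" by (auto simp: fun_eq_iff x_def Transposition.transpose_def)
    show "x \<circ> (x \<circ> x) = id" "y \<circ> y = id" "y \<circ> x = x \<circ> (x \<circ> y)"
      by (auto simp: fun_eq_iff x_def y_def Transposition.transpose_def)
  qed
  have fin: "finite (carrier (sym_group 3))" by (simp add: sym_group_def finite_permutations)
  \<comment> \<open>The subgroup generated by the 3-cycle \<open>x\<close> and the transposition
    \<open>y\<close> also has 6 elements, so it is everything.\<close>
  have "card (carrier (sym_group 3)) = 6"
    using card_permutations[of "{1..3::nat}" 3] by (simp add: sym_group_def fact_numeral)
  moreover have sub: "generate (sym_group 3) {x, y} \<subseteq> carrier (sym_group 3)"
    using S.generate_incl[of "{x, y}"] xy by (simp add: s3_pair_def)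
  ultimately have "generate (sym_group 3) {x, y} = carrier (sym_group 3)"
    using card_subset_eq[OF fin sub] S.card_s3_pair_generate[OF xy] by simp
  moreover have "carrier (sym_group 3) \<inter> {x, y} = {x, y}" using xy by (auto simp: s3_pair_def)
  ultimately have "subgroup_generated (sym_group 3) {x, y} = sym_group 3"
    unfolding subgroup_generated_def by simp
  then show thesis using that xy by blast
qed

lemma (in group) s3_pair_iso_sym_group:
  assumes "s3_pair G x y"
  shows "subgroup_generated G {x, y} \<cong> sym_group 3"
proof -
  obtain u v where "s3_pair (sym_group 3) u v" "subgroup_generated (sym_group 3) {u, v} = sym_group 3"
    by (rule sym_group_3_pair)
  then show ?thesis
    using s3_pair_iso[OF group_axioms sym_group_is_group assms, of 3 u v] by simp
qed

lemma (in group) s3_pair_Gamma_adj_iff: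
  assumes "s3_pair G x y"
  shows "Gamma_adj F G x y \<longleftrightarrow> \<not> in_class F (sym_group 3)"
  unfolding Gamma_adj_def
  using in_class_iso_iff[OF group_subgroup_generated sym_group_is_group s3_pair_iso_sym_group[OF assms]] by blast



section \<open>Groups whose graph contains no complete bipartite subgraph on 3 + 3 vertices\<close>

text \<open>Planarity is kept only as the absence of \<open>K\<^sub>3\<^sub>,\<^sub>3\<close>. The
  sides range over the whole carrier, since an element with a neighbour is a vertex; they are
  automatically disjoint, since adjacent elements do not commute.\<close>

locale K33_free_group = group G for G (structure) +
  fixes F :: "nat monoid set"
  assumes formation: "formation F" and hereditary: "hereditary F" and semiregular: "semiregular F"
    and nilpotent: "contains_nilpotent F" and fin: "finite (carrier G)"
    and K33_free: "\<And>xs ys. set xs \<subseteq> carrier G \<Longrightarrow> set ys \<subseteq> carrier G \<Longrightarrow> distinct xs \<Longrightarrow> distinct ys \<Longrightarrow>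
      length xs = 3 \<Longrightarrow> length ys = 3 \<Longrightarrow> \<exists>x\<in>set xs. \<exists>y\<in>set ys. \<not> Gamma_adj F G x y"
begin

abbreviation R where "R \<equiv> Gamma_adj F G"

lemma R_commute: "R x y \<Longrightarrow> R y x"
  by (simp add: Gamma_adj_commute)

lemma R_mono:
  assumes "R x y" "x' \<in> carrier G" "y' \<in> carrier G" "x \<in> generate G {x', y'}" "y \<in> generate G {x', y'}"
  shows "R x' y'"
  using Gamma_adj_mono[OF formation hereditary group_axioms assms] .

lemma R_imp_not_commute: "R x y \<Longrightarrow> x \<in> carrier G \<Longrightarrow> y \<in> carrier G \<Longrightarrow> x \<otimes> y \<noteq> y \<otimes> x"
  using Gamma_adj_not_commute[OF nilpotent fin] by blast

lemma no_K33:
  assumes "a \<in> carrier G" "b \<in> carrier G" "c \<in> carrier G" "u \<in> carrier G" "v \<in> carrier G" "w \<in> carrier G"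
    and "a \<noteq> b" "a \<noteq> c" "b \<noteq> c" "u \<noteq> v" "u \<noteq> w" "v \<noteq> w"
    and "R a u" "R a v" "R a w" "R b u" "R b v" "R b w" "R c u" "R c v" "R c w"
  shows False
  using K33_free[of "[a, b, c]" "[u, v, w]"] assms by simp

lemma generate_mem_left: "x \<in> generate G {x, y}" and generate_mem_right: "y \<in> generate G {x, y}"
  by (simp_all add: generate.incl)

lemma generate_inv:
  assumes "S \<subseteq> carrier G" "a \<in> generate G S"
  shows "inv a \<in> generate G S"
  using generate_m_inv_closed[OF assms] .

lemma generate_pow: "a \<in> generate G S \<Longrightarrow> a [^] (n::nat) \<in> generate G S"
  by (induction n) (auto intro: generate.one generate.eng)

text \<open>In each new pair, \<open>x\<close> and \<open>y\<close> can be recovered as products, so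
  the new pair generates a group containing \<langle>x, y\<rangle>.\<close>

lemma R_mult:
  assumes "R x y" "x \<in> carrier G" "y \<in> carrier G"
  shows "R x (x \<otimes> y)" "R x (inv x \<otimes> y)" "R x (y \<otimes> x)" "R (inv x) y"
proof -
  show "R x (x \<otimes> y)"
  proof (rule R_mono[OF assms(1)])
    have "inv x \<otimes> (x \<otimes> y) \<in> generate G {x, x \<otimes> y}"
      using assms by (intro generate.eng generate_inv generate_mem_left generate_mem_right) simp
    then show "y \<in> generate G {x, x \<otimes> y}" using assms by (simp add: l_inv_assoc)
  qed (use assms generate_mem_left in auto)
  show "R x (inv x \<otimes> y)"
  proof (rule R_mono[OF assms(1)])
    have "x \<otimes> (inv x \<otimes> y) \<in> generate G {x, inv x \<otimes> y}"
      using assms by (intro generate.eng generate_mem_left generate_mem_right)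
    then show "y \<in> generate G {x, inv x \<otimes> y}" using assms by (simp add: r_inv_assoc)
  qed (use assms generate_mem_left in auto)
  show "R x (y \<otimes> x)"
  proof (rule R_mono[OF assms(1)])
    have "(y \<otimes> x) \<otimes> inv x \<in> generate G {x, y \<otimes> x}"
      using assms by (intro generate.eng generate_inv generate_mem_left generate_mem_right) simp
    then show "y \<in> generate G {x, y \<otimes> x}" using assms by (simp add: m_assoc)
  qed (use assms generate_mem_left in auto)
  show "R (inv x) y"
  proof (rule R_mono[OF assms(1)])
    have "inv (inv x) \<in> generate G {inv x, y}"
      using assms by (intro generate_inv generate_mem_left) simp
    then show "x \<in> generate G {inv x, y}" using assms by simp
  qed (use assms generate_mem_right in auto)
qed

lemma eq_inv_iff: "x \<in> carrier G \<Longrightarrow> y \<in> carrier G \<Longrightarrow> x = inv y \<longleftrightarrow> x \<otimes> y = \<one>"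
  using inv_equality l_inv by metis

text \<open>Otherwise \<open>x\<close>, \<open>inv x\<close>, \<open>y\<close> and
  \<open>x \<otimes> y\<close>, \<open>inv x \<otimes> y\<close>, \<open>y \<otimes> x\<close> are
  the sides of a \<open>K\<^sub>3\<^sub>,\<^sub>3\<close>: each pair across generates \<langle>x,
  y\<rangle>, and the equation to be shown is the only possible coincidence.\<close>

lemma R_imp_inverts:
  assumes "R x y" and c: "x \<in> carrier G" "y \<in> carrier G" and "x \<otimes> x \<noteq> \<one>"
  shows "y \<otimes> x = inv x \<otimes> y"
proof (rule ccontr)
  assume neq: "y \<otimes> x \<noteq> inv x \<otimes> y"
  have nc: "x \<otimes> y \<noteq> y \<otimes> x" using R_imp_not_commute[OF assms(1) c] .
  have ne: "x \<noteq> inv x" using eq_inv_iff[of x x] c assms(4) by simp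
  have "x \<noteq> y" "inv x \<noteq> y" using nc c by auto
  moreover have "x \<otimes> y \<noteq> inv x \<otimes> y" using ne c by simp
  ultimately show False
    using R_mult[OF assms(1) c] R_mult[OF R_commute[OF assms(1)] c(2,1)]
      R_mult[OF R_mult(4)[OF assms(1) c] inv_closed[OF c(1)] c(2)]
      R_mult(1,3)[OF R_commute[OF R_mult(4)[OF assms(1) c]] c(2) inv_closed[OF c(1)]]
      R_mult(4)[OF R_mult(3)[OF assms(1) c] c(1)] ne neq nc c
    by (intro no_K33[of x "inv x" y "x \<otimes> y" "inv x \<otimes> y" "y \<otimes> x"]) simp_all
qed

text \<open>Otherwise \<open>x\<close> and \<open>y\<close> invert each other, which forces
  \<open>x\<^sup>2 = y\<^sup>2\<close>. As in the quaternion group, the commutator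
  \<open>x\<^sup>2\<close> is then central.\<close>

lemma R_imp_involution:
  assumes "R x y" and c: "x \<in> carrier G" "y \<in> carrier G" and x2: "x \<otimes> x \<noteq> \<one>"
  shows "y \<otimes> y = \<one>"
proof (rule ccontr)
  assume y2: "y \<otimes> y \<noteq> \<one>"
  have yx: "y \<otimes> x = inv x \<otimes> y" using R_imp_inverts[OF assms(1) c x2] .
  have xy: "x \<otimes> y = inv y \<otimes> x" using R_imp_inverts[OF R_commute[OF assms(1)] c(2,1) y2] .
  have "x = y \<otimes> (x \<otimes> y)" unfolding xy using c by (simp add: r_inv_assoc)
  also have "\<dots> = inv x \<otimes> (y \<otimes> y)" using yx c by (simp add: m_assoc[symmetric])
  finally have xx: "x \<otimes> x = y \<otimes> y" using c by (metis r_inv_assoc m_closed)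
  have "\<not> R x y"
  proof (rule Gamma_adj_class2[OF nilpotent fin c, of "x \<otimes> x"])
    show "x \<otimes> x \<in> generate G {x, y}" by (intro generate.eng generate_mem_left)
    show "x \<otimes> y = x \<otimes> x \<otimes> (y \<otimes> x)" unfolding yx using c by (simp add: m_assoc r_inv_assoc)
    show "x \<otimes> (x \<otimes> x) = x \<otimes> x \<otimes> x" using c by (simp add: m_assoc)
    show "y \<otimes> (x \<otimes> x) = x \<otimes> x \<otimes> y" unfolding xx using c by (simp add: m_assoc)
  qed
  then show False using assms(1) by blast
qed

text \<open>A root \<open>z\<close> inherits the neighbours of \<open>x\<close>, because \<langle>z,
  w\<rangle> contains \<langle>x, w\<rangle>. A third element \<open>z\<close> would complete a
  \<open>K\<^sub>3\<^sub>,\<^sub>3\<close> with sides \<open>x\<close>, \<open>inv x\<close>,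
  \<open>z\<close> and \<open>y\<close>, \<open>xy\<close>, \<open>x\<^sup>2y\<close>.\<close>

lemma R_root_eq:
  assumes "R x y" and c: "x \<in> carrier G" "y \<in> carrier G" "z \<in> carrier G" and x2: "x \<otimes> x \<noteq> \<one>"
    and z: "z [^] (m::nat) = x"
  shows "z = x \<or> z = inv x"
proof (rule ccontr)
  assume neg: "\<not> (z = x \<or> z = inv x)"
  have Rz: "R z w" if "R x w" "w \<in> carrier G" for w
  proof (rule R_mono[OF that(1)])
    show "x \<in> generate G {z, w}" unfolding z[symmetric] by (intro generate_pow generate_mem_left)
  qed (use that c generate_mem_right in auto)
  have R1: "R x (x \<otimes> y)" "R x (x \<otimes> (x \<otimes> y))"
    using R_mult(1)[OF assms(1) c(1,2)] R_mult(1)[of x "x \<otimes> y"] c by simp_all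
  have ne: "x \<noteq> inv x" using eq_inv_iff[of x x] c x2 by simp
  have x1: "x \<noteq> \<one>" using x2 c by auto
  have d: "y \<noteq> x \<otimes> y" "y \<noteq> x \<otimes> (x \<otimes> y)" "x \<otimes> y \<noteq> x \<otimes> (x \<otimes> y)"
  proof -
    show "y \<noteq> x \<otimes> y" using x1 c by simp
    then show "x \<otimes> y \<noteq> x \<otimes> (x \<otimes> y)" using c by simp
    have "x \<otimes> (x \<otimes> y) = x \<otimes> x \<otimes> y" using c by (simp add: m_assoc)
    then show "y \<noteq> x \<otimes> (x \<otimes> y)" using x2 c by simp
  qed
  show False
    using assms(1) R1 Rz[OF assms(1)] Rz[OF R1(1)] Rz[OF R1(2)]
      R_mult(4)[OF assms(1) c(1,2)] R_mult(4)[OF R1(1)] R_mult(4)[OF R1(2)] ne neg d c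
    by (intro no_K33[of x "inv x" z y "x \<otimes> y" "x \<otimes> (x \<otimes> y)"]) auto
qed

text \<open>Every generator of \<langle>x\<rangle> is a root of \<open>x\<close>, hence
  \<open>x\<close> or \<open>inv x\<close>. So 1 and -1 are the only units modulo the order, and
  testing one unit, chosen by the order modulo 4, leaves 3, 4 and 6.\<close>

lemma R_imp_order:
  assumes "R x y" and c: "x \<in> carrier G" "y \<in> carrier G" and x2: "x \<otimes> x \<noteq> \<one>"
  shows "ord x \<in> {3, 4, 6}"
proof -
  define n where "n = ord x"
  have n0: "n > 0" unfolding n_def using ord_ge_1[OF fin c(1)] by simp
  have pow: "x [^] k = \<one> \<longleftrightarrow> n dvd k" for k :: nat unfolding n_def using pow_eq_id[OF c(1)] .
  have x1: "x \<noteq> \<one>" using x2 c by auto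
  have n1: "\<not> n dvd 1" using pow[of 1] x1 c by simp
  have n2: "\<not> n dvd 2" using pow[of 2] x2 c by (simp add: numeral_2_eq_2)
  \<comment> \<open>The equation says that \<open>k\<close> is a unit modulo \<open>n\<close> with
    inverse \<open>m\<close>; the conclusion, that it is 1 or -1.\<close>
  have key: "n dvd k - 1 \<or> n dvd k + 1" if "k * m = n * l + 1" "k \<ge> 1" for k m l :: nat
  proof -
    have "(x [^] k) [^] m = x [^] (n * l + 1)" using that c by (simp add: nat_pow_pow)
    also have "\<dots> = x [^] (n * l) \<otimes> x" using c by (simp add: nat_pow_mult[symmetric])
    also have "x [^] (n * l) = \<one>" using pow by simp
    finally have "(x [^] k) [^] m = x" using c by simp
    then have "x [^] k = x \<or> x [^] k = inv x" using R_root_eq[OF assms(1) c _ x2, of "x [^] k" m] c by simp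
    then show ?thesis
    proof
      assume "x [^] k = x"
      moreover have "x [^] k = x [^] (k - 1) \<otimes> x" using that(2) c by (cases k) simp_all
      ultimately have "x [^] (k - 1) = \<one>" using c by simp
      then show ?thesis using pow by blast
    next
      assume "x [^] k = inv x"
      then have "x [^] (k + 1) = \<one>" using c by simp
      then show ?thesis using pow by blast
    qed
  qed
  have "n \<in> {3, 4, 6}"
  proof (cases "even n")
    case False
    then obtain i where i: "n = 2 * i + 1" by (rule oddE)
    \<comment> \<open>For odd \<open>n\<close> the unit is 2, with inverse
      \<open>i + 1\<close>.\<close>
    have "n dvd 2 - 1 \<or> n dvd 2 + 1" by (rule key[of 2 "i + 1" 1]) (simp_all add: i)
    then have "n dvd 3" using n1 by simp
    then have "n \<le> 3" by (simp add: dvd_imp_le)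
    then show ?thesis using n1 n2 n0 by (auto simp: i)
  next
    case True
    then obtain q where q: "n = 2 * q" by (rule evenE)
    have small: "\<not> n dvd k" if "0 < k" "k < n" for k using that by (simp add: nat_dvd_not_less)
    show ?thesis
    proof (cases "even q")
      case True
      then obtain i where i: "q = 2 * i" by (rule evenE)
      \<comment> \<open>For even \<open>q\<close>, the number \<open>q + 1\<close> is its own
        inverse modulo \<open>2 * q\<close>.\<close>
      have "n dvd (q + 1) - 1 \<or> n dvd (q + 1) + 1"
        by (rule key[of "q + 1" "q + 1" "i + 1"]) (simp_all add: q i algebra_simps)
      then have "\<not> q + 2 < n" using small[of q] small[of "q + 2"] n0 q by auto
      then show ?thesis using n0 n2 q i by auto
    next
      case False
      then obtain j where j: "q = 2 * j + 1" by (rule oddE)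
      \<comment> \<open>For odd \<open>q\<close>, the number \<open>q + 2\<close> is coprime to
        \<open>2 * q\<close>; the formula for its inverse depends on \<open>q\<close> modulo
        4.\<close>
      have "n dvd (q + 2) - 1 \<or> n dvd (q + 2) + 1"
      proof (cases "even j")
        case True
        then obtain i where i: "j = 2 * i" by (rule evenE)
        show ?thesis by (rule key[of "q + 2" "2 * i + 1" "i + 1"]) (simp_all add: q j i algebra_simps)
      next
        case False
        then obtain i where i: "j = 2 * i + 1" by (rule oddE)
        show ?thesis by (rule key[of "q + 2" "6 * i + 5" "3 * i + 4"]) (simp_all add: q j i algebra_simps)
      qed
      then have "n dvd q + 1 \<or> n dvd q + 3" by (simp add: numeral_3_eq_3)
      then have "\<not> q + 3 < n" using small[of "q + 1"] small[of "q + 3"] n0 q by auto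
      then have "j = 0 \<or> j = 1" using q j by auto
      moreover have "n \<noteq> 2" using n2 by auto
      ultimately show ?thesis using q j by auto
    qed
  qed
  then show ?thesis by (simp add: n_def)
qed

lemma inverts_pow:
  assumes "x \<in> carrier G" "y \<in> carrier G" "y \<otimes> x = inv x \<otimes> y"
  shows "y \<otimes> x [^] (n::nat) = inv (x [^] n) \<otimes> y"
proof (induction n)
  case (Suc n)
  have "y \<otimes> x [^] Suc n = inv (x [^] n) \<otimes> (y \<otimes> x)"
    using Suc assms(1,2) by (simp add: m_assoc[symmetric])
  also have "\<dots> = inv (x \<otimes> x [^] n) \<otimes> y"
    unfolding assms(3) using assms(1,2) by (simp add: m_assoc inv_mult_group)
  also have "x \<otimes> x [^] n = x [^] Suc n" using assms(1) nat_pow_Suc2 by simp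
  finally show ?case .
qed (use assms in simp)

text \<open>Order 4 would make \<langle>x, y\<rangle> dihedral of order 8, where the commutator
  \<open>x\<^sup>2\<close> is central.\<close>

lemma R_imp_order_not_4:
  assumes "R x y" and c: "x \<in> carrier G" "y \<in> carrier G" and x2: "x \<otimes> x \<noteq> \<one>"
  shows "ord x \<noteq> 4"
proof
  assume "ord x = 4"
  then have x4: "x [^] (4::nat) = \<one>" using pow_ord_eq_1[OF c(1)] by simp
  have yx: "y \<otimes> x = inv x \<otimes> y" using R_imp_inverts[OF assms(1) c x2] .
  have xx: "x \<otimes> x = x [^] (2::nat)" using c by (simp add: numeral_2_eq_2)
  have "x [^] (2::nat) \<otimes> x [^] (2::nat) = \<one>" using x4 c by (simp add: nat_pow_mult)
  then have inv2: "inv (x [^] (2::nat)) = x [^] (2::nat)" using c by (intro inv_equality) simp_all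
  have "\<not> R x y"
  proof (rule Gamma_adj_class2[OF nilpotent fin c, of "x \<otimes> x"])
    show "x \<otimes> x \<in> generate G {x, y}" by (intro generate.eng generate_mem_left)
    show "x \<otimes> y = x \<otimes> x \<otimes> (y \<otimes> x)" unfolding yx using c by (simp add: m_assoc r_inv_assoc)
    show "x \<otimes> (x \<otimes> x) = x \<otimes> x \<otimes> x" using c by (simp add: m_assoc)
    show "y \<otimes> (x \<otimes> x) = x \<otimes> x \<otimes> y" unfolding xx inverts_pow[OF c yx] inv2 ..
  qed
  then show False using assms(1) by blast
qed

text \<open>In the dihedral group of order 12 the central involution \<open>x\<^sup>3\<close> lies in \<open>\<I>\<close>, so semiregularity
forces \<open>x\<^sup>2\<close> out of it, which gives the generator \<open>x\<close> enough extra neighbours.\<close>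

lemma R_imp_order_not_6:
  assumes "R x y" and c: "x \<in> carrier G" "y \<in> carrier G" and x2: "x \<otimes> x \<noteq> \<one>"
  shows "ord x \<noteq> 6"
proof
  assume o: "ord x = 6"
  have pow: "x [^] k = \<one> \<longleftrightarrow> 6 dvd k" for k :: nat using pow_eq_id[OF c(1)] o by simp
  have yx: "y \<otimes> x = inv x \<otimes> y" using R_imp_inverts[OF assms(1) c x2] .
  \<comment> \<open>Semiregularity is applied inside \<langle>x, y\<rangle>, where \<open>v\<close>
    below is central.\<close>
  let ?K = "generate G {x, y}"
  let ?GK = "G\<lparr>carrier := ?K\<rparr>"
  have K: "subgroup ?K G" using c by (intro generate_is_subgroup) simp
  have Kc: "k \<in> carrier G" if "k \<in> ?K" for k using subgroup.mem_carrier[OF K that] .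
  have finK: "finite (carrier ?GK)" using finite_subset[OF subgroup.subset[OF K] fin] by simp
  have sub: "subgroup (I_F F ?GK) ?GK"
    by (rule I_F_subgroup[OF semiregular subgroup_imp_group[OF K] finK])
  have I: "u \<in> I_F F ?GK \<longleftrightarrow> u \<in> ?K \<and> (\<forall>g\<in>?K. \<not> R u g)" for u
    unfolding I_F_alt using Gamma_adj_subgroup[OF group_axioms K] by auto
  define u where "u = x [^] (2::nat)"
  define v where "v = x [^] (3::nat)"
  have uv: "u \<in> carrier G" "v \<in> carrier G" unfolding u_def v_def using c by simp_all
  have uK: "u \<in> ?K" "v \<in> ?K" unfolding u_def v_def by (intro generate_pow generate_mem_left)+
  have "v \<otimes> v = \<one>" unfolding v_def using c pow[of 6] by (simp add: nat_pow_mult)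
  then have inv_v: "inv v = v" using uv by (intro inv_equality)
  have "x \<otimes> v = v \<otimes> x" unfolding v_def using c by (simp add: numeral_3_eq_3 m_assoc)
  moreover have "y \<otimes> v = v \<otimes> y" using inverts_pow[OF c yx, of 3] inv_v unfolding v_def by simp
  ultimately have "g \<otimes> v = v \<otimes> g" if "g \<in> ?K" for g
    using that uv c by (intro commute_generate[of g "{x, y}" v]) auto
  then have vI: "v \<in> I_F F ?GK"
    unfolding I using uK uv Kc R_imp_not_commute by metis
  have "u \<notin> I_F F ?GK"
  proof
    assume uI: "u \<in> I_F F ?GK"
    \<comment> \<open>This product is \<open>x\<close>, which has the neighbour
      \<open>y\<close>.\<close>
    have "inv\<^bsub>?GK\<^esub> u \<otimes> v \<in> I_F F ?GK"
      using subgroup.m_closed[OF sub subgroup.m_inv_closed[OF sub uI] vI] by simp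
    moreover have "inv\<^bsub>?GK\<^esub> u = inv u" using m_inv_consistent[OF K uK(1)] .
    moreover have "v = u \<otimes> x" unfolding u_def v_def by (simp add: numeral_3_eq_3 numeral_2_eq_2)
    ultimately have "x \<in> I_F F ?GK" using uv c by (simp add: l_inv_assoc)
    then show False using I assms(1) generate_mem_right by blast
  qed
  then obtain g where g: "g \<in> ?K" "R u g" using I uK by blast
  have gc: "g \<in> carrier G" using Kc g by blast
  have Rx: "R x w" if "R u w" "w \<in> carrier G" for w
  proof (rule R_mono[OF that(1)])
    show "u \<in> generate G {x, w}" unfolding u_def by (intro generate_pow generate_mem_left)
  qed (use that c generate_mem_right in auto)
  have R1: "R u (u \<otimes> g)" "R u (u \<otimes> (u \<otimes> g))"
    using R_mult(1)[OF g(2) uv(1) gc] R_mult(1)[of u "u \<otimes> g"] uv gc by simp_all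
  have ne: "x \<noteq> inv x" using eq_inv_iff[of x x] c x2 by simp
  have x1: "x \<noteq> \<one>" using x2 c by auto
  have ux: "u \<noteq> x" "u \<noteq> inv x"
  proof -
    have "u = x \<otimes> x" unfolding u_def using c by (simp add: numeral_2_eq_2)
    then show "u \<noteq> x" using x1 c by simp
    have "u \<otimes> x = v" unfolding u_def v_def by (simp add: numeral_3_eq_3 numeral_2_eq_2)
    then show "u \<noteq> inv x" using eq_inv_iff[of u x] uv c pow[of 3] by (simp add: v_def)
  qed
  have d: "g \<noteq> u \<otimes> g" "g \<noteq> u \<otimes> (u \<otimes> g)" "u \<otimes> g \<noteq> u \<otimes> (u \<otimes> g)"
  proof -
    have "u \<noteq> \<one>" using pow[of 2] by (simp add: u_def)
    then show "g \<noteq> u \<otimes> g" using uv gc by simp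
    then show "u \<otimes> g \<noteq> u \<otimes> (u \<otimes> g)" using uv gc by simp
    have "u \<otimes> u \<noteq> \<one>" using pow[of 4] c by (simp add: u_def nat_pow_mult)
    moreover have "u \<otimes> (u \<otimes> g) = u \<otimes> u \<otimes> g" using uv gc by (simp add: m_assoc)
    ultimately show "g \<noteq> u \<otimes> (u \<otimes> g)" using uv gc by simp
  qed
  \<comment> \<open>The sides are \<open>x\<close>, \<open>inv x\<close>, \<open>u\<close> and
    \<open>g\<close>, \<open>u \<otimes> g\<close>, \<open>u\<^sup>2g\<close>; \<open>x\<close>
    inherits the neighbours of its power \<open>u\<close>.\<close>
  show False
    using g(2) R1 Rx[OF g(2) gc] Rx[OF R1(1)] Rx[OF R1(2)]
      R_mult(4)[OF Rx[OF g(2) gc] c(1) gc] R_mult(4)[OF Rx[OF R1(1)] c(1)] R_mult(4)[OF Rx[OF R1(2)] c(1)]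
      ne ux d c uv gc
    by (intro no_K33[of x "inv x" u g "u \<otimes> g" "u \<otimes> (u \<otimes> g)"]) auto
qed

lemma R_imp_s3_pair:
  assumes "R x y" and c: "x \<in> carrier G" "y \<in> carrier G" and x2: "x \<otimes> x \<noteq> \<one>"
  shows "s3_pair G x y"
proof -
  have "ord x = 3"
    using R_imp_order[OF assms] R_imp_order_not_4[OF assms] R_imp_order_not_6[OF assms] by simp
  then have "x [^] (3::nat) = \<one>" using pow_ord_eq_1[OF c(1)] by simp
  then have x3: "x \<otimes> (x \<otimes> x) = \<one>" using c by (simp add: numeral_3_eq_3 m_assoc)
  then have "inv x = x \<otimes> x" using c by (intro inv_equality) (simp_all add: m_assoc)
  then show ?thesis
    unfolding s3_pair_def
    using R_imp_inverts[OF assms] R_imp_involution[OF assms] x3 x2 c by (auto simp: m_assoc)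
qed

lemma R_imp_order_2_or_3:
  assumes "R x y" "x \<in> carrier G" "y \<in> carrier G"
  shows "x \<otimes> x = \<one> \<or> x \<otimes> (x \<otimes> x) = \<one>"
  using R_imp_s3_pair[OF assms] unfolding s3_pair_def by blast

text \<open>If \<open>x\<close> or \<open>y\<close> does not square to the identity, the pair itself
  serves. If both do, they do not commute, so \<open>x \<otimes> y\<close> does not square to the
  identity, and it is still adjacent to \<open>y\<close>.\<close>

lemma R_imp_sym_group_notin_class:
  assumes "R x y" and c: "x \<in> carrier G" "y \<in> carrier G"
  obtains u v where "s3_pair G u v" "\<not> in_class F (sym_group 3)"
proof (cases "x \<otimes> x = \<one>")
  case False
  then show ?thesis
    using that R_imp_s3_pair[OF assms] s3_pair_Gamma_adj_iff assms(1) by blast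
next
  case x2: True
  show ?thesis
  proof (cases "y \<otimes> y = \<one>")
    case False
    then show ?thesis
      using that R_imp_s3_pair[OF R_commute[OF assms(1)] c(2,1)] s3_pair_Gamma_adj_iff R_commute[OF assms(1)] by blast
  next
    case y2: True
    have R': "R (x \<otimes> y) y" using R_commute[OF R_mult(3)[OF R_commute[OF assms(1)] c(2,1)]] .
    have "(x \<otimes> y) \<otimes> (x \<otimes> y) \<noteq> \<one>"
    proof
      assume "(x \<otimes> y) \<otimes> (x \<otimes> y) = \<one>"
      then have "x \<otimes> y = inv (x \<otimes> y)" using c by (simp add: eq_inv_iff)
      also have "\<dots> = inv y \<otimes> inv x" using c by (simp add: inv_mult_group)
      also have "inv x = x" using x2 c by (simp add: inv_equality)
      also have "inv y = y" using y2 c by (simp add: inv_equality)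
      finally show False using R_imp_not_commute[OF assms(1) c] by blast
    qed
    then show ?thesis
      using that R_imp_s3_pair[OF R'] s3_pair_Gamma_adj_iff R' c by blast
  qed
qed

end



section \<open>Groups containing a copy of \<open>S\<^sub>3\<close> outside the class\<close>

lemma (in group) right_inverse_eq: "a \<in> carrier G \<Longrightarrow> w \<in> carrier G \<Longrightarrow> a \<otimes> w = \<one> \<Longrightarrow> w = inv a"
  using inv_equality inv_inv by metis

text \<open>Rewrite rules towards a power of \<open>x\<close> followed by a power of
  \<open>y\<close>; the versions with a trailing \<open>b\<close> act inside longer right-nested
  products.\<close>

lemma (in group) s3_pair_rules:
  assumes "s3_pair G x y"
  shows "x \<in> carrier G" "y \<in> carrier G" "x \<otimes> (x \<otimes> x) = \<one>" "y \<otimes> y = \<one>" "y \<otimes> x = x \<otimes> (x \<otimes> y)"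
    and "inv x = x \<otimes> x" "inv y = y"
    and "b \<in> carrier G \<Longrightarrow> x \<otimes> (x \<otimes> (x \<otimes> b)) = b" "b \<in> carrier G \<Longrightarrow> y \<otimes> (y \<otimes> b) = b"
    and "b \<in> carrier G \<Longrightarrow> y \<otimes> (x \<otimes> b) = x \<otimes> (x \<otimes> (y \<otimes> b))"
proof -
  show c: "x \<in> carrier G" "y \<in> carrier G"
    and r: "x \<otimes> (x \<otimes> x) = \<one>" "y \<otimes> y = \<one>" "y \<otimes> x = x \<otimes> (x \<otimes> y)"
    using assms by (auto simp: s3_pair_def)
  show "inv x = x \<otimes> x" "inv y = y"
    using c r by (auto intro!: inv_equality simp: m_assoc)
  assume b: "b \<in> carrier G"
  have "x \<otimes> (x \<otimes> (x \<otimes> b)) = x \<otimes> (x \<otimes> x) \<otimes> b" using b c by (simp add: m_assoc)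
  then show "x \<otimes> (x \<otimes> (x \<otimes> b)) = b" using b r by simp
  have "y \<otimes> (y \<otimes> b) = y \<otimes> y \<otimes> b" using b c by (simp add: m_assoc)
  then show "y \<otimes> (y \<otimes> b) = b" using b r by simp
  have "y \<otimes> (x \<otimes> b) = y \<otimes> x \<otimes> b" using b c by (simp add: m_assoc)
  then show "y \<otimes> (x \<otimes> b) = x \<otimes> (x \<otimes> (y \<otimes> b))" using b c r by (simp add: m_assoc)
qed

lemma (in group) s3_pair_generate_eq:
  assumes "s3_pair G x y"
  shows "generate G {x, y} = {\<one>, x, x \<otimes> x, y, x \<otimes> y, x \<otimes> (x \<otimes> y)}"
proof -
  have idx: "s3_index = {(0,0),(1,0),(2,0),(0,1),(1,1),(2,1)}"
    by (auto simp: numeral_2_eq_2 numeral_3_eq_3 less_Suc_eq)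
  show ?thesis
    unfolding s3_pair_generate[OF assms] idx using s3_pair_rules(1,2)[OF assms]
    by (simp add: s3_word_def numeral_2_eq_2 m_assoc)
qed

text \<open>All three involutions \<open>y\<close>, \<open>xy\<close>, \<open>x\<^sup>2y\<close>
  invert \<open>x\<close>, so each can take the place of \<open>y\<close>.\<close>

lemma (in group) s3_pair_rotate:
  assumes "s3_pair G x y"
  shows "s3_pair G x (x \<otimes> y)" "s3_pair G x (x \<otimes> (x \<otimes> y))"
proof -
  have rot: "s3_pair G x (x \<otimes> y)" if "s3_pair G x y" for y
    using that s3_pair_rules[OF that] by (simp add: s3_pair_def m_assoc)
  show "s3_pair G x (x \<otimes> y)" by (rule rot[OF assms])
  then show "s3_pair G x (x \<otimes> (x \<otimes> y))" by (rule rot)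
qed

lemma (in group) s3_pair_distinct:
  assumes "s3_pair G x y"
  shows "x \<noteq> \<one>" "x \<otimes> x \<noteq> \<one>" "x \<noteq> x \<otimes> x"
    "y \<noteq> x \<otimes> y" "y \<noteq> x \<otimes> (x \<otimes> y)" "x \<otimes> y \<noteq> x \<otimes> (x \<otimes> y)" "y \<otimes> x \<noteq> x \<otimes> y" "y \<noteq> \<one>"
proof -
  note r = s3_pair_rules[OF assms]
  show x1: "x \<noteq> \<one>" using assms by (simp add: s3_pair_def)
  show "x \<noteq> x \<otimes> x" using x1 r(1) by simp
  show xx: "x \<otimes> x \<noteq> \<one>" using x1 r(1,3) by auto
  show n: "y \<noteq> x \<otimes> y" using x1 r(1,2) by simp
  show n': "x \<otimes> y \<noteq> x \<otimes> (x \<otimes> y)" using n r(1,2) by simp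
  have "x \<otimes> (x \<otimes> y) = x \<otimes> x \<otimes> y" using r(1,2) by (simp add: m_assoc)
  then show "y \<noteq> x \<otimes> (x \<otimes> y)" using xx r(1,2) by simp
  show nc: "y \<otimes> x \<noteq> x \<otimes> y" unfolding r(5) using n' by simp
  show "y \<noteq> \<one>" using nc r(1) by auto
qed

lemma (in group) conjugation_iso:
  assumes "g \<in> carrier G"
  shows "(\<lambda>a. g \<otimes> a \<otimes> inv g) \<in> iso G G"
proof (rule isoI)
  show "(\<lambda>a. g \<otimes> a \<otimes> inv g) \<in> hom G G"
    by (rule homI) (use assms in \<open>simp_all add: m_assoc l_inv_assoc\<close>)
  show "bij_betw (\<lambda>a. g \<otimes> a \<otimes> inv g) (carrier G) (carrier G)"
    by (rule bij_betwI[where g = "\<lambda>a. inv g \<otimes> a \<otimes> g"])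
      (use assms in \<open>auto simp: m_assoc l_inv_assoc r_inv_assoc\<close>)
qed

text \<open>Conjugation is an automorphism, so it permutes the elements without neighbours.\<close>

lemma (in group) I_F_normal:
  assumes "semiregular F" "finite (carrier G)"
  shows "I_F F G \<lhd> G"
proof (rule normal_invI)
  show "subgroup (I_F F G) G" by (rule I_F_subgroup[OF assms(1) group_axioms assms(2)])
  fix g h assume g: "g \<in> carrier G" and h: "h \<in> I_F F G"
  have hc: "h \<in> carrier G" using h by (simp add: I_F_alt)
  have "\<not> Gamma_adj F G (g \<otimes> h \<otimes> inv g) w" if w: "w \<in> carrier G" for w
  proof -
    have "w = g \<otimes> (inv g \<otimes> w \<otimes> g) \<otimes> inv g" using g w by (simp add: m_assoc r_inv_assoc)
    then show ?thesis
      using Gamma_adj_iso[OF group_axioms group_axioms conjugation_iso[OF g] hc, of "inv g \<otimes> w \<otimes> g" F] h g w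
      by (simp add: I_F_alt)
  qed
  then show "g \<otimes> h \<otimes> inv g \<in> I_F F G" using g hc by (simp add: I_F_alt)
qed

lemma (in group) subgroup_generated_hom_image:
  assumes "group H" "h \<in> hom G H" "S \<subseteq> carrier G" "formation F" "in_class F (subgroup_generated G S)"
  shows "in_class F (subgroup_generated H (h ` S))"
proof (rule in_class_hom_image[OF assms(4) _ _ assms(5), of _ h])
  interpret h: group_hom G H h
    using assms(1,2) group_axioms by (simp add: group_hom_def group_hom_axioms_def)
  have "h ` S \<subseteq> carrier H" using assms(3) by auto
  then have im: "carrier (subgroup_generated H (h ` S)) = h ` carrier (subgroup_generated G S)"
    using h.generate_img[OF assms(3)] assms(3) by (simp add: carrier_subgroup_generated Int_absorb1)
  then show "h ` carrier (subgroup_generated G S) = carrier (subgroup_generated H (h ` S))" by simp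
  show "h \<in> hom (subgroup_generated G S) (subgroup_generated H (h ` S))"
  proof (rule homI)
    fix a b assume a: "a \<in> carrier (subgroup_generated G S)"
    show "h a \<in> carrier (subgroup_generated H (h ` S))" unfolding im using a by simp
    assume b: "b \<in> carrier (subgroup_generated G S)"
    have "a \<in> carrier G" "b \<in> carrier G" using a b carrier_subgroup_generated_subset by blast+
    then show "h (a \<otimes>\<^bsub>subgroup_generated G S\<^esub> b) = h a \<otimes>\<^bsub>subgroup_generated H (h ` S)\<^esub> h b"
      by (simp add: subgroup_generated_def)
  qed
  show "group (subgroup_generated H (h ` S))" by (rule group.group_subgroup_generated[OF assms(1)])
qed simp

locale K33_free_group_with_S3 = K33_free_group +
  fixes x y
  assumes xy: "s3_pair G x y" and S3: "\<not> in_class F (sym_group 3)"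
begin

lemmas rules = s3_pair_rules[OF xy]
lemmas distinct_facts = s3_pair_distinct[OF xy]

lemma s3_pair_imp_R: "s3_pair G u v \<Longrightarrow> R u v"
  using s3_pair_Gamma_adj_iff S3 by blast

lemma R_x: "R x y" "R x (x \<otimes> y)" "R x (x \<otimes> (x \<otimes> y))"
  using s3_pair_imp_R xy s3_pair_rotate[OF xy] by blast+

text \<open>Otherwise \<open>x\<close>, \<open>x \<otimes> x\<close>, \<open>c\<close> and the three
  involutions of \<langle>x, y\<rangle> are the sides of a
  \<open>K\<^sub>3\<^sub>,\<^sub>3\<close>.\<close>

lemma no_third_neighbour:
  assumes c: "c \<in> carrier G" "R c y" "R c (x \<otimes> y)" "R c (x \<otimes> (x \<otimes> y))"
  shows "c = x \<or> c = x \<otimes> x"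
proof (rule ccontr)
  assume "\<not> ?thesis"
  moreover have "R (x \<otimes> x) y" "R (x \<otimes> x) (x \<otimes> y)" "R (x \<otimes> x) (x \<otimes> (x \<otimes> y))"
    using R_mult(4)[OF R_x(1)] R_mult(4)[OF R_x(2)] R_mult(4)[OF R_x(3)] rules(1,2,6) by simp_all
  ultimately show False
    using no_K33[of x "x \<otimes> x" c y "x \<otimes> y" "x \<otimes> (x \<otimes> y)"] assms R_x distinct_facts rules(1,2) by auto
qed

text \<open>Modulo \<open>I_F F G\<close> the elements \<open>x \<otimes> z\<close> and
  \<open>x\<close> agree. If \<langle>x z, w\<rangle> were in the class, so would be its image in
  the quotient, which is again a copy of \<open>S\<^sub>3\<close>.\<close>

lemma R_mult_I_F:
  assumes z: "z \<in> I_F F G" and w: "s3_pair G x w"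
  shows "R (x \<otimes> z) w"
proof (rule ccontr)
  assume "\<not> R (x \<otimes> z) w"
  then have cl: "in_class F (subgroup_generated G {x \<otimes> z, w})" by (simp add: Gamma_adj_def)
  define N where "N = I_F F G"
  interpret N: normal N G unfolding N_def by (rule I_F_normal[OF semiregular fin])
  let ?Q = "G Mod N"
  let ?h = "\<lambda>a. N #> a"
  interpret Q: group ?Q by (rule N.factorgroup_is_group)
  interpret h: group_hom G ?Q ?h
    using N.r_coset_hom_Mod group_axioms Q.group_axioms by (simp add: group_hom_def group_hom_axioms_def)
  have zc: "z \<in> carrier G" using z by (simp add: I_F_def)
  have wc: "w \<in> carrier G" using w by (simp add: s3_pair_def)
  have one: "\<one>\<^bsub>?Q\<^esub> = N" by (simp add: FactGroup_def)
  have "?h z = N" using z zc N.subgroup_axioms by (simp add: N_def coset_join2)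
  then have hxz: "?h (x \<otimes> z) = ?h x" using h.hom_mult[of x z] rules(1) zc one Q.r_one[of "?h x"] h.hom_closed[of x] by simp
  \<comment> \<open>\<open>x\<close> has the neighbour \<open>y\<close>, so its image in the
    quotient is nontrivial, as \<open>s3_pair\<close> requires.\<close>
  have xN: "x \<notin> N" unfolding N_def I_F_alt using R_x(1) rules(2) by blast
  have "?h x \<noteq> N" using xN rules(1) coset_join1[OF _ rules(1) N.subgroup_axioms] by blast
  then have "s3_pair ?Q (?h x) (?h w)"
    using w rules(1) wc one unfolding s3_pair_def by (simp add: h.hom_mult[symmetric] del: h.hom_mult mult_FactGroup)
  then have "\<not> in_class F (subgroup_generated ?Q {?h x, ?h w})"
    using Q.s3_pair_Gamma_adj_iff[of "?h x" "?h w" F] S3 by (simp add: Gamma_adj_def)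
  moreover have "in_class F (subgroup_generated ?Q (?h ` {x \<otimes> z, w}))"
    by (rule subgroup_generated_hom_image[OF Q.group_axioms N.r_coset_hom_Mod _ formation cl])
      (use rules(1) zc wc in auto)
  ultimately show False by (simp add: hxz)
qed

text \<open>\<open>x \<otimes> z\<close> is adjacent to all three involutions, so it is
  \<open>x\<close> or \<open>x \<otimes> x\<close>; and \<open>z\<close> cannot be \<open>x\<close>,
  which has a neighbour.\<close>

lemma I_F_trivial: "z \<in> I_F F G \<Longrightarrow> z = \<one>"
proof -
  assume z: "z \<in> I_F F G"
  then have zc: "z \<in> carrier G" by (simp add: I_F_def)
  have "x \<otimes> z = x \<or> x \<otimes> z = x \<otimes> x"
    using no_third_neighbour[of "x \<otimes> z"] R_mult_I_F[OF z] xy s3_pair_rotate[OF xy] zc rules(1) by simp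
  then have "z = \<one> \<or> z = x" using zc rules(1) by simp
  moreover have "z \<noteq> x" using z R_x(1) rules(2) unfolding I_F_alt by blast
  ultimately show "z = \<one>" by blast
qed

lemma order_2_or_3:
  assumes "g \<in> carrier G"
  shows "g \<otimes> g = \<one> \<or> g \<otimes> (g \<otimes> g) = \<one>"
proof (cases "g \<in> I_F F G")
  case True
  then show ?thesis using I_F_trivial[OF True] by simp
next
  case False
  then obtain h where "h \<in> carrier G" "R g h" using assms by (auto simp: I_F_alt)
  then show ?thesis using R_imp_order_2_or_3 assms by blast
qed

lemma centralizer_x:
  assumes c: "c \<in> carrier G" and cx: "c \<otimes> x = x \<otimes> c"
  shows "c \<in> {\<one>, x, x \<otimes> x}"
proof -
  have cx': "c \<otimes> (x \<otimes> b) = x \<otimes> (c \<otimes> b)" if "b \<in> carrier G" for b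
    using that cx c rules(1) by (metis m_assoc)
  consider "c \<otimes> c = \<one>" | "c \<otimes> (c \<otimes> c) = \<one>" using order_2_or_3[OF c] by blast
  then show ?thesis
  proof cases
    case 1
    have cc: "c \<otimes> (c \<otimes> b) = b" if "b \<in> carrier G" for b
      using 1 that c by (simp add: m_assoc[symmetric])
    \<comment> \<open>The square of \<open>c \<otimes> x\<close> is \<open>x \<otimes> x\<close>,
      not the identity, so its cube, which is \<open>c\<close>, must be.\<close>
    have "(c \<otimes> x) \<otimes> (c \<otimes> x) = x \<otimes> x"
      using c rules(1) by (simp add: m_assoc cx cx' cc 1)
    moreover have "(c \<otimes> x) \<otimes> ((c \<otimes> x) \<otimes> (c \<otimes> x)) = c"
      using c rules(1,3,8) by (simp add: m_assoc cx cx' cc 1)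
    ultimately show ?thesis using order_2_or_3[of "c \<otimes> x"] c rules(1) distinct_facts(2) by auto
  next
    case 2
    have ci: "inv c = c \<otimes> c" using 2 c by (intro inv_equality) (simp_all add: m_assoc)
    show ?thesis
    proof (cases "c = \<one>")
      case False
      consider "(c \<otimes> y) \<otimes> (c \<otimes> y) = \<one>" | "(c \<otimes> y) \<otimes> ((c \<otimes> y) \<otimes> (c \<otimes> y)) = \<one>"
        using order_2_or_3[of "c \<otimes> y"] c rules(2) by auto
      then show ?thesis
      proof cases
        case 1
        \<comment> \<open>Here \<open>y\<close> inverts \<open>c\<close>, and so do the other
          involutions because \<open>x\<close> commutes with \<open>c\<close>. Thus \<open>c\<close>
          is a common neighbour of all three.\<close>
        then have "y \<otimes> (c \<otimes> y) = c \<otimes> c"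
          using c rules(2) ci right_inverse_eq[of c "y \<otimes> (c \<otimes> y)"] by (simp add: m_assoc)
        then have "y \<otimes> (c \<otimes> y) \<otimes> y = c \<otimes> c \<otimes> y" by simp
        then have yc: "y \<otimes> c = c \<otimes> (c \<otimes> y)" using c rules(2,4) by (simp add: m_assoc)
        have pair: "s3_pair G c y"
          unfolding s3_pair_def using c rules(2,4) yc \<open>c \<noteq> \<one>\<close> \<open>c \<otimes> (c \<otimes> c) = \<one>\<close> by simp
        have pair_x: "s3_pair G c (x \<otimes> w)" if "s3_pair G c w" "s3_pair G x w" for w
        proof -
          note cw = s3_pair_rules[OF that(1)] and xw = s3_pair_rules[OF s3_pair_rotate(1)[OF that(2)]]
          have "x \<otimes> w \<otimes> c = c \<otimes> (c \<otimes> (x \<otimes> w))"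
            using c cw(2) rules(1) by (simp add: m_assoc cw(5) cx')
          then show ?thesis
            unfolding s3_pair_def using xw(2,4) cw(1,3) \<open>c \<noteq> \<one>\<close> by blast
        qed
        have "R c y" "R c (x \<otimes> y)" "R c (x \<otimes> (x \<otimes> y))"
          using s3_pair_imp_R pair pair_x[OF pair xy] pair_x[OF pair_x[OF pair xy] s3_pair_rotate(1)[OF xy]] by blast+
        then show ?thesis using no_third_neighbour[OF c] by blast
      next
        case 2
        \<comment> \<open>The cube of \<open>c \<otimes> y\<close> without its last
          \<open>y\<close>, so \<open>e = y\<close>. But \<open>e\<close> contains \<open>y\<close>
          an even number of times and \<open>c\<close> commutes with \<open>x\<close>, so
          \<open>e\<close> commutes with \<open>x\<close>.\<close>
        define e where "e = c \<otimes> (y \<otimes> (c \<otimes> (y \<otimes> c)))"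
        have "e \<otimes> y = \<one>" unfolding e_def using 2 c rules(2) by (simp add: m_assoc)
        then have "e = y" using inv_equality[of e y] c rules(2,7) by (simp add: e_def)
        moreover have "e \<otimes> x = x \<otimes> e"
          unfolding e_def using c rules(1,2) by (simp add: m_assoc cx cx' rules(5,8,10))
        ultimately show ?thesis using distinct_facts(7) by simp
      qed
    qed simp
  qed
qed

section \<open>The normalizer of \<langle>x\<rangle> and the involutions of \<open>G\<close>\<close>

lemmas H_eq = s3_pair_generate_eq[OF xy]

lemma H_subgroup: "subgroup (generate G {x, y}) G"
  by (rule generate_is_subgroup) (use rules(1,2) in simp)

text \<open>If \<open>g\<close> inverts \<open>x\<close>, then \<open>g \<otimes> y\<close>
  centralizes \<open>x\<close>, which reduces this case to \<open>centralizer_x\<close>.\<close>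

lemma normalizer_x:
  assumes g: "g \<in> carrier G" and "g \<otimes> x = x \<otimes> g \<or> g \<otimes> x = x \<otimes> (x \<otimes> g)"
  shows "g \<in> generate G {x, y}"
  using assms(2)
proof
  assume "g \<otimes> x = x \<otimes> g"
  then show ?thesis using centralizer_x[OF g] unfolding H_eq by blast
next
  assume gx: "g \<otimes> x = x \<otimes> (x \<otimes> g)"
  have gx': "g \<otimes> (x \<otimes> b) = x \<otimes> (x \<otimes> (g \<otimes> b))" if "b \<in> carrier G" for b
  proof -
    have "g \<otimes> (x \<otimes> b) = g \<otimes> x \<otimes> b" using that g rules(1) by (simp add: m_assoc)
    then show ?thesis unfolding gx using that g rules(1) by (simp add: m_assoc)
  qed
  have "(g \<otimes> y) \<otimes> x = x \<otimes> (g \<otimes> y)"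
    using g rules(1,2) by (simp add: m_assoc rules(5,8,10) gx')
  then have "g \<otimes> y \<in> generate G {x, y}"
    using centralizer_x[of "g \<otimes> y"] g rules(2) unfolding H_eq by blast
  then have "g \<otimes> y \<otimes> y \<in> generate G {x, y}" by (rule generate.eng[OF _ generate_mem_right])
  then show ?thesis using g rules(2,4) by (simp add: m_assoc)
qed

text \<open>If \<open>t\<close> and \<open>a\<close> commuted, then \<open>t\<close>,
  \<open>x\<close>, \<open>a\<close> would satisfy the relations of \<open>S\<^sub>4\<close> for (1
  2)(3 4), (1 2 3), (1 2), giving an element of order 4 against \<open>order_2_or_3\<close>.\<close>

lemma outer_involution_not_commute:
  assumes t: "t \<in> carrier G" "t \<otimes> t = \<one>" "t \<notin> generate G {x, y}" and a: "s3_pair G x a"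
  shows "t \<otimes> a \<noteq> a \<otimes> t"
proof
  assume ta: "t \<otimes> a = a \<otimes> t"
  note ra = s3_pair_rules[OF a]
  have t1: "t \<noteq> \<one>" using t(3) generate.one by metis
  have ti: "inv t = t" using t by (simp add: inv_equality)
  have tt: "t \<otimes> (t \<otimes> b) = b" if "b \<in> carrier G" for b
    using that t by (simp add: m_assoc[symmetric])
  have at': "a \<otimes> (t \<otimes> b) = t \<otimes> (a \<otimes> b)" if "b \<in> carrier G" for b
    using that ta t(1) ra(2) by (metis m_assoc)
  \<comment> \<open>An involution \<open>t \<otimes> x\<close> would mean that \<open>t\<close>
    inverts \<open>x\<close>, and then \<open>normalizer_x\<close> puts \<open>t\<close> into
    \<langle>x, y\<rangle>.\<close>
  have "(t \<otimes> x) \<otimes> (t \<otimes> x) \<noteq> \<one>"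
  proof
    assume "(t \<otimes> x) \<otimes> (t \<otimes> x) = \<one>"
    then have "t \<otimes> x = inv (t \<otimes> x)" using t rules(1) by (simp add: eq_inv_iff)
    then have "t \<otimes> x = x \<otimes> (x \<otimes> t)" using t rules(1,6) ti by (simp add: inv_mult_group m_assoc)
    then show False using normalizer_x t by blast
  qed
  then have "(t \<otimes> x) \<otimes> ((t \<otimes> x) \<otimes> (t \<otimes> x)) = \<one>"
    using order_2_or_3[of "t \<otimes> x"] t rules(1) by blast
  then have "(t \<otimes> (x \<otimes> t)) \<otimes> (x \<otimes> (t \<otimes> x)) = \<one>" using t rules(1) by (simp add: m_assoc)
  then have "t \<otimes> (x \<otimes> t) = inv (x \<otimes> (t \<otimes> x))" using t rules(1) by (simp add: eq_inv_iff)
  then have t_x_t: "t \<otimes> (x \<otimes> t) = x \<otimes> (x \<otimes> (t \<otimes> (x \<otimes> x)))"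
    using t rules(1,6) ti by (simp add: inv_mult_group m_assoc)
  have t_x_t': "t \<otimes> (x \<otimes> (t \<otimes> b)) = x \<otimes> (x \<otimes> (t \<otimes> (x \<otimes> (x \<otimes> b))))" if "b \<in> carrier G" for b
  proof -
    have "t \<otimes> (x \<otimes> (t \<otimes> b)) = t \<otimes> (x \<otimes> t) \<otimes> b" using that t rules(1) by (simp add: m_assoc)
    then show ?thesis unfolding t_x_t using that t rules(1) by (simp add: m_assoc)
  qed
  \<comment> \<open>The conjugate of \<open>t\<close> by \<open>x\<close>, times \<open>a\<close>.
    In the model this is a 4-cycle whose square is \<open>t\<close>.\<close>
  define w where "w = x \<otimes> (t \<otimes> (x \<otimes> (x \<otimes> a)))"
  have wc: "w \<in> carrier G" unfolding w_def using t rules(1) ra(2) by simp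
  have ww: "w \<otimes> w = t"
    unfolding w_def using t(1,2) ra(1,2)
    by (simp add: m_assoc ra(3,4,5,8,9,10) ta[symmetric] at' tt t_x_t')
  have "w \<otimes> (w \<otimes> w) \<noteq> \<one>"
  proof
    assume "w \<otimes> (w \<otimes> w) = \<one>"
    then have "w = inv t" unfolding ww using wc t by (simp add: eq_inv_iff)
    then show False using ww t t1 ti by simp
  qed
  then show False using order_2_or_3[OF wc] ww t1 by simp
qed

text \<open>Let \<open>t\<close> lie outside. For each involution \<open>a\<close> of \<langle>x,
  y\<rangle>, \<open>t \<otimes> a\<close> does not square to the identity, so it has order 3 and is
  inverted by \<open>a\<close>. Hence \<open>t\<close> is adjacent to all three, against
  \<open>no_third_neighbour\<close>.\<close>

lemma involution_in_H:
  assumes t: "t \<in> carrier G" "t \<otimes> t = \<one>"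
  shows "t \<in> generate G {x, y}"
proof (rule ccontr)
  assume tH: "t \<notin> generate G {x, y}"
  have ti: "inv t = t" using t by (simp add: inv_equality)
  have tt: "t \<otimes> (t \<otimes> b) = b" if "b \<in> carrier G" for b
    using that t by (simp add: m_assoc[symmetric])
  have "R t a" if a: "s3_pair G x a" for a
  proof -
    note ra = s3_pair_rules[OF a]
    have nc: "t \<otimes> a \<noteq> a \<otimes> t" using outer_involution_not_commute[OF t tH a] .
    have inv_ta: "inv (t \<otimes> a) = a \<otimes> t" using t ra(2,7) ti by (simp add: inv_mult_group)
    have "(t \<otimes> a) \<otimes> (t \<otimes> a) \<noteq> \<one>" using nc eq_inv_iff[of "t \<otimes> a" "t \<otimes> a"] t ra(2) inv_ta by simp
    then have cube: "(t \<otimes> a) \<otimes> ((t \<otimes> a) \<otimes> (t \<otimes> a)) = \<one>"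
      using order_2_or_3[of "t \<otimes> a"] t ra(2) by simp
    then have sq: "(t \<otimes> a) \<otimes> (t \<otimes> a) = a \<otimes> t"
      using right_inverse_eq[OF _ _ cube] t ra(2) inv_ta by simp
    have "a \<otimes> (t \<otimes> a) = (t \<otimes> a) \<otimes> (t \<otimes> a) \<otimes> a" unfolding sq using t ra(2) by (simp add: m_assoc)
    then have "a \<otimes> (t \<otimes> a) = (t \<otimes> a) \<otimes> ((t \<otimes> a) \<otimes> a)" using t ra(2) by (simp add: m_assoc)
    moreover have "t \<otimes> a \<noteq> \<one>" using nc eq_inv_iff[of t a] t ra(2,7) by auto
    ultimately have "s3_pair G (t \<otimes> a) a"
      unfolding s3_pair_def using cube t ra(2,4) by simp
    then have "R (t \<otimes> a) a" by (rule s3_pair_imp_R)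
    then show ?thesis
      by (rule R_mono) (use t ra(2) in \<open>auto intro: generate.eng generate.incl\<close>)
  qed
  then have "t = x \<or> t = x \<otimes> x"
    using no_third_neighbour[OF t(1)] xy s3_pair_rotate[OF xy] by blast
  then show False using tH unfolding H_eq by blast
qed

text \<open>Conjugates of involutions stay in \<langle>x, y\<rangle>, hence so do those of
  \<open>x\<close>, a product of two involutions. Having order 3, they are \<open>x\<close> or
  \<open>x \<otimes> x\<close>, so every \<open>g\<close> normalizes \<langle>x\<rangle>.\<close>

lemma carrier_eq_H: "carrier G = generate G {x, y}"
proof
  show "generate G {x, y} \<subseteq> carrier G" using subgroup.subset[OF H_subgroup] .
  show "carrier G \<subseteq> generate G {x, y}"
  proof
    fix g assume g: "g \<in> carrier G"
    have conj: "g \<otimes> (a \<otimes> inv g) \<in> generate G {x, y}" if "a \<in> carrier G" "a \<otimes> a = \<one>" for a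
    proof (rule involution_in_H)
      have "a \<otimes> (a \<otimes> b) = b" if "b \<in> carrier G" for b
        using that \<open>a \<in> carrier G\<close> \<open>a \<otimes> a = \<one>\<close> by (simp add: m_assoc[symmetric])
      then show "g \<otimes> (a \<otimes> inv g) \<otimes> (g \<otimes> (a \<otimes> inv g)) = \<one>"
        using g that by (simp add: m_assoc l_inv_assoc)
    qed (use g that in simp)
    define u where "u = g \<otimes> (x \<otimes> inv g)"
    have uc: "u \<in> carrier G" unfolding u_def using g rules(1) by simp
    \<comment> \<open>Conjugates the factorization of \<open>x\<close> into the involutions
      \<open>x \<otimes> y\<close> and \<open>y\<close>.\<close>
    have "g \<otimes> ((x \<otimes> y) \<otimes> inv g) \<otimes> (g \<otimes> (y \<otimes> inv g)) = u"
      unfolding u_def using g rules(1,2) by (simp add: m_assoc l_inv_assoc rules(9))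
    moreover have "(x \<otimes> y) \<otimes> (x \<otimes> y) = \<one>" using s3_pair_rotate(1)[OF xy] by (simp add: s3_pair_def)
    ultimately have uH: "u \<in> generate G {x, y}"
      using generate.eng[OF conj conj, of "x \<otimes> y" y] rules(1,2,4) by simp
    have ux: "g \<otimes> x = u \<otimes> g" unfolding u_def using g rules(1) by (simp add: m_assoc)
    have u1: "u \<noteq> \<one>"
    proof
      assume "u = \<one>"
      then have "g \<otimes> x = g" using ux g by simp
      then show False using g rules(1) distinct_facts(1) by simp
    qed
    have "u \<otimes> (u \<otimes> u) = \<one>"
      unfolding u_def using g rules(1) by (simp add: m_assoc l_inv_assoc rules(8))
    then have "u \<otimes> u \<noteq> \<one>" using u1 uc by auto
    moreover have "a \<otimes> a = \<one>" if "a \<in> {y, x \<otimes> y, x \<otimes> (x \<otimes> y)}" for a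
      using that s3_pair_rotate[OF xy] xy by (auto simp: s3_pair_def)
    ultimately have "u = x \<or> u = x \<otimes> x" using uH u1 unfolding H_eq by blast
    then have "g \<otimes> x = x \<otimes> g \<or> g \<otimes> x = x \<otimes> (x \<otimes> g)"
      unfolding ux using g rules(1) by (auto simp: m_assoc)
    then show "g \<in> generate G {x, y}" using normalizer_x[OF g] by blast
  qed
qed

lemma iso_sym_group: "G \<cong> sym_group 3"
proof -
  have "carrier G \<inter> {x, y} = {x, y}" using rules(1,2) by auto
  then have "subgroup_generated G {x, y} = G"
    unfolding subgroup_generated_def by (simp add: carrier_eq_H[symmetric])
  then show ?thesis using s3_pair_iso_sym_group[OF xy] by simp
qed

end



section \<open>Planarity\<close>

lemma iso_s3_pair:
  assumes "group G" "group H" "k \<in> iso G H" "s3_pair G x y"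
  shows "s3_pair H (k x) (k y)"
proof -
  interpret k: group_hom G H k
    using assms by (simp add: group_hom_def group_hom_axioms_def iso_def)
  have c: "x \<in> carrier G" "y \<in> carrier G" using assms(4) by (auto simp: s3_pair_def)
  have "inj_on k (carrier G)" using assms(3) by (simp add: iso_def bij_betw_def)
  then have "k x \<noteq> \<one>\<^bsub>H\<^esub>" using assms(4) c by (metis k.hom_one inj_onD k.G.one_closed s3_pair_def)
  then show ?thesis
    using assms(4) c unfolding s3_pair_def by (simp add: k.hom_mult[symmetric] del: k.hom_mult)
qed

text \<open>At most the five nontrivial elements are vertices, and the commuting pair
  \<open>x\<close>, \<open>x \<otimes> x\<close> supplies the missing edge of
  \<open>K\<^sub>5\<close>.\<close>

lemma (in group) sym_group_3_iso_planar:
  assumes "contains_nilpotent F" "finite (carrier G)" "G \<cong> sym_group 3"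
  shows "planar_graph (Gamma_vertices F G) (Gamma_adj F G)"
proof -
  obtain u v where uv: "s3_pair (sym_group 3) u v" "subgroup_generated (sym_group 3) {u, v} = sym_group 3"
    by (rule sym_group_3_pair)
  obtain k where k: "k \<in> iso (sym_group 3) G"
    using iso_sym[OF assms(3)] unfolding is_iso_def by blast
  define x where "x = k u"
  define y where "y = k v"
  have xy: "s3_pair G x y"
    unfolding x_def y_def by (rule iso_s3_pair[OF sym_group_is_group group_axioms k uv(1)])
  note r = s3_pair_rules[OF xy]
  have H: "generate G {x, y} \<subseteq> carrier G" using generate_incl[of "{x, y}"] r(1,2) by simp
  have "card (carrier (sym_group 3)) = 6"
    using group.card_s3_pair_generate[OF sym_group_is_group uv(1)] arg_cong[OF uv(2), of carrier] uv(1)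
    by (simp add: carrier_subgroup_generated s3_pair_def)
  then have "card (carrier G) = 6" using iso_same_card[OF assms(3)] by simp
  then have G: "carrier G = {\<one>, x, x \<otimes> x, y, x \<otimes> y, x \<otimes> (x \<otimes> y)}"
    using card_subset_eq[OF assms(2) H] card_s3_pair_generate[OF xy] s3_pair_generate_eq[OF xy] by simp
  have nadj: "\<not> Gamma_adj F G a b" if "a \<in> carrier G" "b \<in> carrier G" "a \<otimes> b = b \<otimes> a" for a b
    using Gamma_adj_not_commute[OF assms(1,2) that] .
  have V: "Gamma_vertices F G \<subseteq> {x, x \<otimes> x, y, x \<otimes> y, x \<otimes> (x \<otimes> y)}"
  proof -
    have "\<one> \<in> I_F F G" unfolding I_F_alt using nadj[of \<one>] by simp
    then show ?thesis unfolding Gamma_vertices_def G by blast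
  qed
  \<comment> \<open>Involutions get 0, 1, 2. On the vertices the default value 4 is taken only at
    \<open>x \<otimes> x\<close>, so \<open>x\<close> and \<open>x \<otimes> x\<close> get the
    non-adjacent places 3 and 4.\<close>
  define f :: "'a \<Rightarrow> nat" where "f a = (if a = y then 0 else if a = x \<otimes> y then 1 else if a = x \<otimes> (x \<otimes> y) then 2
    else if a = x then 3 else 4)" for a
  show ?thesis
  proof (rule K5_minus_edge_planar)
    show "inj_on f (Gamma_vertices F G)"
      using V unfolding inj_on_def f_def by (auto split: if_splits)
    show "f ` Gamma_vertices F G \<subseteq> {..<5}" unfolding f_def by auto
    fix a b assume ab: "a \<in> Gamma_vertices F G" "b \<in> Gamma_vertices F G" "Gamma_adj F G a b"
    have low: "c = x \<or> c = x \<otimes> x" if "c \<in> Gamma_vertices F G" "f c \<ge> 3" for c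
      using V that unfolding f_def by (auto split: if_splits)
    show "{f a, f b} \<noteq> {3, 4}"
    proof
      assume "{f a, f b} = {3, 4}"
      then have "f a \<ge> 3" "f b \<ge> 3" by (auto simp: doubleton_eq_iff)
      then have "a \<otimes> b = b \<otimes> a" using low[OF ab(1)] low[OF ab(2)] r(1) by (auto simp: m_assoc)
      then show False using nadj[of a b] ab by (simp add: Gamma_vertices_def)
    qed
  qed
qed

lemma planar_imp_sym_group_3:
  assumes "formation F" "hereditary F" "two_recognizable F" "semiregular F" "contains_nilpotent F"
    and "group G" "finite (carrier G)" and planar: "planar_graph (Gamma_vertices F G) (Gamma_adj F G)"
    and "\<not> in_class F G"
  shows "G \<cong> sym_group 3"
proof -
  interpret group G by fact
  interpret K33_free_group G F
  proof
    fix xs ys :: "'a list"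
    assume xs: "set xs \<subseteq> carrier G" "set ys \<subseteq> carrier G" "distinct xs" "distinct ys" "length xs = 3" "length ys = 3"
    show "\<exists>x\<in>set xs. \<exists>y\<in>set ys. \<not> Gamma_adj F G x y"
    proof (rule ccontr)
      assume "\<not> ?thesis"
      then have adj: "Gamma_adj F G x y" if "x \<in> set xs" "y \<in> set ys" for x y using that by blast
      obtain x0 y0 where "x0 \<in> set xs" "y0 \<in> set ys" using xs(5,6) by (metis length_0_conv list.set_intros(1) neq_Nil_conv zero_neq_numeral)
      \<comment> \<open>Every listed element has a neighbour on the other side, so it is not in
        \<open>I_F F G\<close>.\<close>
      then have "set xs \<subseteq> Gamma_vertices F G" "set ys \<subseteq> Gamma_vertices F G"
        using adj xs(1,2) Gamma_adj_commute[of F G] unfolding Gamma_vertices_def I_F_alt by blast+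
      moreover have "x \<noteq> y" if "x \<in> set xs" "y \<in> set ys" for x y
        using adj[OF that] Gamma_adj_not_commute[OF assms(5,7), of x x] that xs(1) by auto
      ultimately show False
        using planar_graph_no_K33_lists[OF planar _ _ xs(3-6)] adj by blast
    qed
  qed fact+
  \<comment> \<open>Since \<open>G\<close> is not in the class, 2-recognizability yields an
    edge.\<close>
  obtain x y where "Gamma_adj F G x y" "x \<in> carrier G" "y \<in> carrier G"
    using two_recognizable_in_class[OF assms(3,6,7)] assms(9) by blast
  then obtain u v where uv: "s3_pair G u v" "\<not> in_class F (sym_group 3)"
    by (rule R_imp_sym_group_notin_class)
  interpret K33_free_group_with_S3 G F u v
    by unfold_locales (use uv in auto)
  show ?thesis by (rule iso_sym_group)
qed

theorem theorem1p6:
  fixes F :: "nat monoid set" and G :: "'a monoid"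
  assumes "formation F" and "hereditary F" and "two_recognizable F" and "semiregular F"
    and "contains_nilpotent F"
    and "group G" and "finite (carrier G)"
  shows "planar_graph (Gamma_vertices F G) (Gamma_adj F G)
           \<longleftrightarrow> (in_class F G \<or> G \<cong> sym_group 3)"
proof
  assume "planar_graph (Gamma_vertices F G) (Gamma_adj F G)"
  then show "in_class F G \<or> G \<cong> sym_group 3"
    using planar_imp_sym_group_3[OF assms] by blast
next
  assume "in_class F G \<or> G \<cong> sym_group 3"
  then show "planar_graph (Gamma_vertices F G) (Gamma_adj F G)"
  proof
    assume "in_class F G"
    then have "Gamma_vertices F G = {}"
      using in_class_no_Gamma_adj[OF assms(1,2,6)] unfolding Gamma_vertices_def I_F_alt by blast
    then show ?thesis by (simp add: planar_graph_def)
  next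
    assume "G \<cong> sym_group 3"
    then show ?thesis by (rule group.sym_group_3_iso_planar[OF assms(6,5,7)])
  qed
qed

end
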